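(* Let $h:\Sigma^c\to\mathcal R$ be a random tornado tabulation hash function with $d$ derived characters. For any fixed set $X\subseteq\Sigma^c$ with $|X|\le|\Sigma|/2$, with probability at least $$1-7|X|^3\left(\frac{3}{|\Sigma|}\right)^{d+1}-\frac{1}{2^{|\Sigma|/2}},$$ $h$ is fully random on $X$, i.e. $h|_X$ is uniformly distributed over $\mathcal R^X$.
   Context: Let $\Sigma=\{0,1,\dots,2^k-1\}$ be an alphabet of characters, identified with $k$-bit strings, where $\oplus$ denotes bitwise xor; throughout $|\Sigma|\ge 2^8$. Let $\mathcal R=\{0,\dots,2^r-1\}$, viewed as $r$-bit strings. For $b\ge1$, a simple tabulation hash function $g:\Sigma^b\to\mathcal R'$ (with $\mathcal R'$ a set of bit strings) is $g(x_1\cdots x_b)=T_1[x_1]\oplus\cdots\oplus T_b[x_b]$, where $T_1,\dots,T_b:\Sigma\to\mathcal R'$ are independent fully random tables. A random tornado tabulation hash function $h:\Sigma^c\to\mathcal R$ with $d\ge1$ derived characters consists of mutually independent simple tabulation functions $\tilde h_i:\Sigma^{c+i-1}\to\Sigma$ for $i=0,\dots,d$ and $\hat h:\Sigma^{c+d}\to\mathcal R$. For a key $x=x_1\cdots x_c$, its derived key is $\tilde h(x)=\tilde x_1\cdots\tilde x_{c+d}\in\Sigma^{c+d}$ with $\tilde x_i=x_i$ for $i<c$, $\tilde x_c=x_c\oplus\tilde h_0(\tilde x_1\cdots\tilde x_{c-1})$, and $\tilde x_i=\tilde h_{i-c}(\tilde x_1\cdots\tilde x_{i-1})$ for $c<i\le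 c+d$. Then $h(x)=\hat h(\tilde h(x))$. *)

theory Defs
  imports "HOL-Probability.Probability"
begin

text \<open>Characters are naturals below 2^k (k-bit strings), xor is bitwise xor on nat.
Keys in Sigma^b are lists of length b. A simple tabulation function on b characters
is given by b tables T 0, ..., T (b-1); entry j of the key is looked up in table j.\<close>

definition simtab :: "(nat \<Rightarrow> nat \<Rightarrow> nat) \<Rightarrow> nat \<Rightarrow> nat list \<Rightarrow> nat" where
  "simtab T b x = fold (\<lambda>j acc. Bit_Operations.xor acc (T j (x ! j))) [0..<b] 0"

text \<open>Tt i is the family of tables of the simple tabulation function h~_i
(i = 0..d), which has c+i-1 input characters.  Extension step: derived character
number c+i+1 (1-based) is h~_(i+1) applied to the first c+i derived characters.\<close>

fun tornado_ext :: "(nat \<Rightarrow> nat \<Rightarrow> nat \<Rightarrow> nat) \<Rightarrow> nat \<Rightarrow> nat \<Rightarrow> nat list \<Rightarrow> nat list" where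
  "tornado_ext Tt c 0 y = y"
| "tornado_ext Tt c (Suc i) y =
     (let z = tornado_ext Tt c i y in z @ [simtab (Tt (Suc i)) (c + i) z])"

definition derived_key :: "(nat \<Rightarrow> nat \<Rightarrow> nat \<Rightarrow> nat) \<Rightarrow> nat \<Rightarrow> nat \<Rightarrow> nat list \<Rightarrow> nat list" where
  "derived_key Tt c d x =
     tornado_ext Tt c d
       (take (c - 1) x @ [Bit_Operations.xor (x ! (c - 1)) (simtab (Tt 0) (c - 1) (take (c - 1) x))])"

definition tornado_hash ::
  "nat \<Rightarrow> nat \<Rightarrow> (nat \<Rightarrow> nat \<Rightarrow> nat \<Rightarrow> nat) \<times> (nat \<Rightarrow> nat \<Rightarrow> nat) \<Rightarrow> nat list \<Rightarrow> nat" where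
  "tornado_hash c d T x = simtab (snd T) (c + d) (derived_key (fst T) c d x)"

text \<open>Outcome space: all choices of the tables (entries outside the relevant
domain fixed to 0).  The uniform distribution on it makes all table entries
independent and fully random.\<close>

definition derived_tables :: "nat \<Rightarrow> nat \<Rightarrow> nat \<Rightarrow> (nat \<Rightarrow> nat \<Rightarrow> nat \<Rightarrow> nat) set" where
  "derived_tables k c d = {Tt. \<forall>i j a.
      (i \<le> d \<and> j < c + i - 1 \<and> a < 2^k \<longrightarrow> Tt i j a < 2^k) \<and>
      (\<not> (i \<le> d \<and> j < c + i - 1 \<and> a < 2^k) \<longrightarrow> Tt i j a = 0)}"

definition final_tables :: "nat \<Rightarrow> nat \<Rightarrow> nat \<Rightarrow> nat \<Rightarrow> (nat \<Rightarrow> nat \<Rightarrow> nat) set" where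
  "final_tables k r c d = {Th. \<forall>j a.
      (j < c + d \<and> a < 2^k \<longrightarrow> Th j a < 2^r) \<and>
      (\<not> (j < c + d \<and> a < 2^k) \<longrightarrow> Th j a = 0)}"

definition tornado_space :: "nat \<Rightarrow> nat \<Rightarrow> nat \<Rightarrow> nat \<Rightarrow>
    ((nat \<Rightarrow> nat \<Rightarrow> nat \<Rightarrow> nat) \<times> (nat \<Rightarrow> nat \<Rightarrow> nat)) pmf" where
  "tornado_space k r c d = pmf_of_set (derived_tables k c d \<times> final_tables k r c d)"

text \<open>"With probability at least p, h is fully random on X": there is an event E
of probability at least p such that, conditioned on E, the restriction of h to X
is uniformly distributed on R^X (written without division:
P(E and h|X = f) = P(E) / |R|^|X| for every f : X -> R).\<close>

definition fully_random_whp ::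
  "'w pmf \<Rightarrow> ('w \<Rightarrow> 'x \<Rightarrow> 'v) \<Rightarrow> 'x set \<Rightarrow> 'v set \<Rightarrow> real \<Rightarrow> bool" where
  "fully_random_whp M h X R p \<longleftrightarrow>
     (\<exists>E. measure_pmf.prob M E \<ge> p \<and>
       (\<forall>f \<in> X \<rightarrow>\<^sub>E R.
          measure_pmf.prob M {w \<in> E. restrict (h w) X = f}
            = measure_pmf.prob M E / real (card R) ^ card X))"

end

theory Submission
  imports Defs
begin

text \<open>
  The function is fully random on \<open>X\<close> as soon as the derived keys of \<open>X\<close> are linearly independent
  over \<open>GF(2)\<close>, that is, no nonempty \<open>Z \<subseteq> X\<close> contains every position character an even number of
  times. Write \<open>N = |\<Sigma>|\<close> and call a set dependent at level \<open>i\<close> if it violates this for the characters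
  preceding derived character \<open>i\<close>. A dependent set is perfectly matched by equality of each derived
  character, and pairs that are jointly independent at level \<open>i\<close> are matched with probability
  \<open>1 / N\<close> each.

  For the top two levels, the two matchings of a dependent set \<open>Z\<close> form alternating cycles. A minimal
  alternating structure whose pairs become dependent has independent pairs except for the last one,
  whose last key is determined by the others; so with \<open>2 u + 1\<close> free keys there are \<open>2 u\<close> independent
  pairs, and the expected number of such structures is of order \<open>|X|\<^sup>3 / N\<^sup>2\<close>, with geometrically
  decreasing terms since \<open>|X| \<le> N / 2\<close>. The completed dependency is a set of \<open>2 m\<close> keys that must be
  dependent at the lower levels. Exploring its matchings pair by pair until the first dependency and
  recursing into the dependent subset shows that this has probability at most \<open>2\<^bsup>m - 2\<^esup> (3 / N)\<close> to the
  number of levels; the weight \<open>2\<^bsup>m - 2\<^esup>\<close> is absorbed by the geometric series.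
\<close>

section \<open>Matchings and first dependencies\<close>

definition matching :: "'a set set \<Rightarrow> bool" where
  "matching E \<longleftrightarrow> finite E \<and> (\<forall>e\<in>E. card e = 2) \<and> disjoint E"

text \<open>A perfect matching of \<open>Z\<close>, encoded as a fixed-point-free involution so that
  two matchings can be followed alternately by applying functions.\<close>

definition pairing :: "('a \<Rightarrow> 'a) \<Rightarrow> 'a set \<Rightarrow> bool" where
  "pairing f Z \<longleftrightarrow> (\<forall>x\<in>Z. f x \<in> Z \<and> f x \<noteq> x \<and> f (f x) = x)"

definition edges :: "('a \<Rightarrow> 'a) \<Rightarrow> 'a set \<Rightarrow> 'a set set" where
  "edges f A = (\<lambda>x. {x, f x}) ` A"

text \<open>For disjoint pairs the union is the sum over GF(2), so with \<open>K\<close> the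
  collection of dependent sets this is linear independence of the pairs.\<close>

definition indep :: "'a set set \<Rightarrow> 'a set set \<Rightarrow> bool" where
  "indep K E \<longleftrightarrow> (\<forall>E'\<subseteq>E. E' \<noteq> {} \<longrightarrow> \<Union>E' \<notin> K)"

definition matched :: "('a \<Rightarrow> 'b) \<Rightarrow> 'a set set \<Rightarrow> bool" where
  "matched D E \<longleftrightarrow> (\<forall>e\<in>E. \<forall>x\<in>e. \<forall>y\<in>e. D x = D y)"

definition pick :: "'a set \<Rightarrow> 'a" where
  "pick A = (SOME x. x \<in> A)"

lemma pick_in: "A \<noteq> {} \<Longrightarrow> pick A \<in> A"
  unfolding pick_def by (simp add: some_in_eq)

text \<open>The matchings of \<^term>\<open>j\<close> pairs inside \<^term>\<open>Z\<close> in which every pair covers the canonical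
  uncovered point at the time it is added. Fixing this order is what keeps the count at
  \<open>(|Z| - 1) (|Z| - 3) \<dots>\<close> instead of one factor \<open>|Z|\<^sup>2\<close> per pair.\<close>
fun greedy :: "'a set \<Rightarrow> nat \<Rightarrow> 'a set set set" where
  "greedy Z 0 = {{}}"
| "greedy Z (Suc j) = (\<Union>E\<in>greedy Z j.
     (\<lambda>y. insert {pick (Z - \<Union>E), y} E) ` (Z - \<Union>E - {pick (Z - \<Union>E)}))"

section \<open>Counting and exploring matchings in greedy order\<close>

lemma matching_subset: "matching E \<Longrightarrow> E' \<subseteq> E \<Longrightarrow> matching E'"
  unfolding matching_def by (auto intro: finite_subset pairwise_subset)

lemma card_Union_matching:
  assumes "matching E" shows "card (\<Union>E) = 2 * card E"
proof -
  have "card (\<Union>E) = sum card E"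
    using assms unfolding matching_def
    by (intro card_Union_disjoint) (auto intro: card_ge_0_finite)
  also have "\<dots> = 2 * card E"
    using assms unfolding matching_def by simp
  finally show ?thesis .
qed

lemma finite_Union_matching: "matching E \<Longrightarrow> finite (\<Union>E)"
  unfolding matching_def by (metis card.infinite finite_Union zero_neq_numeral)

lemma matching_insert:
  assumes "matching E" "x \<notin> \<Union>E" "y \<notin> \<Union>E" "x \<noteq> y"
  shows "matching (insert {x, y} E)"
  using assms unfolding matching_def by (auto simp: pairwise_insert disjnt_def)

lemma greedy_props:
  assumes "finite Z" "E \<in> greedy Z j"
  shows "matching E \<and> \<Union>E \<subseteq> Z \<and> card E = j"
  using assms(2)
proof (induction j arbitrary: E)
  case 0
  then show ?case by (simp add: matching_def)
next
  case (Suc j)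
  then obtain F y where F: "F \<in> greedy Z j" and y: "y \<in> Z - \<Union>F - {pick (Z - \<Union>F)}"
    and E: "E = insert {pick (Z - \<Union>F), y} F"
    unfolding greedy.simps by (elim UN_E imageE) metis
  have IH: "matching F" "\<Union>F \<subseteq> Z" "card F = j" using Suc.IH[OF F] by auto
  have p: "pick (Z - \<Union>F) \<in> Z - \<Union>F" using y by (intro pick_in) auto
  have "matching E"
    unfolding E using IH p y by (intro matching_insert) auto
  moreover have "{pick (Z - \<Union>F), y} \<notin> F" using p by auto
  ultimately show ?case using IH p y E by (auto simp: matching_def)
qed

lemma finite_greedy: "finite Z \<Longrightarrow> finite (greedy Z j)"
  by (induction j) auto

text \<open>Once \<open>j\<close> pairs are chosen, the first endpoint of the next pair is forced
  and \<open>card Z - 2 * j - 1\<close> points remain for the second one.\<close>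

lemma card_greedy_le:
  assumes "finite Z"
  shows "card (greedy Z j) \<le> (\<Prod>l<j. card Z - 1 - 2 * l)"
proof (induction j)
  case 0
  then show ?case by simp
next
  case (Suc j)
  have "card (greedy Z (Suc j)) \<le>
    (\<Sum>E\<in>greedy Z j. card ((\<lambda>y. insert {pick (Z - \<Union>E), y} E) ` (Z - \<Union>E - {pick (Z - \<Union>E)})))"
    using finite_greedy[OF assms] by (simp add: card_UN_le)
  also have "\<dots> \<le> (\<Sum>E\<in>greedy Z j. card Z - 1 - 2 * j)"
  proof (rule sum_mono)
    fix E assume E: "E \<in> greedy Z j"
    note pr = greedy_props[OF assms E]
    have c: "card (Z - \<Union>E) = card Z - 2 * j"
      using pr card_Union_matching[of E] finite_Union_matching[of E] by (simp add: card_Diff_subset)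
    have "card ((\<lambda>y. insert {pick (Z - \<Union>E), y} E) ` (Z - \<Union>E - {pick (Z - \<Union>E)}))
      \<le> card (Z - \<Union>E - {pick (Z - \<Union>E)})"
      using assms by (intro card_image_le) auto
    also have "\<dots> \<le> card (Z - \<Union>E) - 1"
    proof (cases "Z - \<Union>E = {}")
      case False
      then show ?thesis using pick_in[OF False] assms by (simp add: card_Diff_singleton)
    qed (metis card.empty empty_Diff le0)
    finally show "card ((\<lambda>y. insert {pick (Z - \<Union>E), y} E) ` (Z - \<Union>E - {pick (Z - \<Union>E)}))
      \<le> card Z - 1 - 2 * j"
      using c by simp
  qed
  also have "\<dots> = card (greedy Z j) * (card Z - 1 - 2 * j)" by simp
  also have "\<dots> \<le> (\<Prod>l<j. card Z - 1 - 2 * l) * (card Z - 1 - 2 * j)"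
    using Suc.IH by (rule mult_le_mono1)
  finally show ?case by (simp add: mult.commute)
qed

lemma Union_edges: "pairing f A \<Longrightarrow> \<Union>(edges f A) = A"
  unfolding pairing_def edges_def by auto

lemma matching_edges:
  assumes "finite A" "pairing f A" shows "matching (edges f A)"
proof -
  have "disjoint (edges f A)"
  proof (rule pairwiseI)
    fix e e' assume "e \<in> edges f A" "e' \<in> edges f A" "e \<noteq> e'"
    then obtain x y where xy: "x \<in> A" "y \<in> A" "e = {x, f x}" "e' = {y, f y}" "{x, f x} \<noteq> {y, f y}"
      unfolding edges_def by auto
    moreover have "f (f x) = x" "f (f y) = y" using xy assms(2) unfolding pairing_def by auto
    ultimately show "disjnt e e'" unfolding disjnt_def by (auto simp: doubleton_eq_iff)
  qed
  moreover have "card e = 2" if e: "e \<in> edges f A" for e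
  proof -
    obtain x where "x \<in> A" "e = {x, f x}" using e unfolding edges_def by auto
    moreover have "f x \<noteq> x" using calculation assms(2) unfolding pairing_def by auto
    ultimately show ?thesis by simp
  qed
  ultimately show ?thesis using assms(1) unfolding matching_def by (auto simp: edges_def)
qed

lemma matched_edges:
  "pairing f Z \<Longrightarrow> \<forall>x\<in>Z. D (f x) = D x \<Longrightarrow> E \<subseteq> edges f Z \<Longrightarrow> matched D E"
  unfolding matched_def edges_def by auto

text \<open>The points covered by \<open>E\<close> are closed under \<open>f\<close>, so the partner
  of an uncovered point is uncovered as well. The greedy order can therefore follow any given
  pairing.\<close>

lemma greedy_extend:
  assumes "finite Z" "pairing f Z" "E \<in> greedy Z j" "E \<subseteq> edges f Z" "\<Union>E \<noteq> Z"
  defines "p \<equiv> pick (Z - \<Union>E)"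
  shows "p \<in> Z - \<Union>E" "f p \<in> Z - \<Union>E - {p}" "insert {p, f p} E \<in> greedy Z (Suc j)"
    "insert {p, f p} E \<subseteq> edges f Z"
proof -
  have sub: "\<Union>E \<subseteq> Z" using greedy_props[OF assms(1,3)] by auto
  show p: "p \<in> Z - \<Union>E" unfolding p_def using sub assms(5) by (intro pick_in) auto
  have "f p \<notin> \<Union>E"
  proof
    assume "f p \<in> \<Union>E"
    then obtain x where x: "x \<in> Z" "{x, f x} \<in> E" "f p \<in> {x, f x}"
      using assms(4) unfolding edges_def by fastforce
    have "f (f p) = p" "f (f x) = x" using p x assms(2) unfolding pairing_def by auto
    with x(3) have "p \<in> {x, f x}" by (metis insert_iff singleton_iff)
    with x(2) p show False by auto
  qed
  then show fp: "f p \<in> Z - \<Union>E - {p}" using p assms(2) unfolding pairing_def by auto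
  then show "insert {p, f p} E \<in> greedy Z (Suc j)"
    using assms(3) unfolding p_def by auto
  show "insert {p, f p} E \<subseteq> edges f Z" using assms(4) p unfolding edges_def by auto
qed

lemma greedy_Union_ne:
  assumes "finite Z" "E \<in> greedy Z j" "2 * j < card Z"
  shows "\<Union>E \<noteq> Z"
  using greedy_props[OF assms(1,2)] card_Union_matching[of E] assms(3) by auto

lemma card_pairing:
  assumes "finite Z" "pairing f Z" shows "card Z = 2 * card (edges f Z)"
  using card_Union_matching[OF matching_edges[OF assms]] Union_edges[OF assms(2)] by simp

lemma greedy_full:
  assumes "finite Z" "pairing f Z" "E \<in> greedy Z (card Z div 2)" "E \<subseteq> edges f Z"
  shows "E = edges f Z"
proof (rule card_subset_eq)
  show "finite (edges f Z)" using assms(1) by (simp add: edges_def)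
  show "card E = card (edges f Z)"
    using greedy_props[OF assms(1,3)] card_pairing[OF assms(1,2)] by simp
qed (fact assms(4))

text \<open>Lets a union bound over \<open>greedy\<close> reach every perfect matching of
  \<open>Z\<close>.\<close>

lemma edges_in_greedy:
  assumes "finite Z" "pairing f Z"
  shows "edges f Z \<in> greedy Z (card Z div 2)"
proof -
  have "\<exists>E\<in>greedy Z j. E \<subseteq> edges f Z" if "j \<le> card Z div 2" for j
    using that
  proof (induction j)
    case 0
    then show ?case by auto
  next
    case (Suc j)
    then obtain E where E: "E \<in> greedy Z j" "E \<subseteq> edges f Z" by auto
    have "\<Union>E \<noteq> Z" using Suc.prems by (intro greedy_Union_ne[OF assms(1) E(1)]) auto
    from greedy_extend(3,4)[OF assms E this] show ?case by blast
  qed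
  from this[of "card Z div 2"] obtain E where E: "E \<in> greedy Z (card Z div 2)" "E \<subseteq> edges f Z" by auto
  then show ?thesis using greedy_full[OF assms E] by simp
qed

text \<open>Adding the pairs of \<open>f\<close> in greedy order must at some point destroy
  independence, since all of them together cover \<open>Z\<close>. The newly dependent subfamily
  contains the pair added last, and \<open>pairs\<close> prevents it from consisting of that pair
  alone, hence \<open>E' \<noteq> {}\<close>. The last pair is recorded only through its endpoint
  \<open>y\<close>, because no equality of characters is charged for it.\<close>

lemma greedy_first_dependency:
  assumes "finite Z" "pairing f Z" "Z \<in> K" "Z \<noteq> {}"
    and pairs: "\<And>x y. x \<in> Z \<Longrightarrow> y \<in> Z \<Longrightarrow> x \<noteq> y \<Longrightarrow> {x, y} \<notin> K"
  shows "\<exists>j E E'. 0 < j \<and> j < card Z div 2 \<and> E \<in> greedy Z j \<and> E \<subseteq> edges f Z \<and> indep K E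
    \<and> E' \<subseteq> E \<and> E' \<noteq> {} \<and> (\<exists>y\<in>Z - \<Union>E - {pick (Z - \<Union>E)}. {pick (Z - \<Union>E), y} \<union> \<Union>E' \<in> K)"
proof -
  have "\<exists>j E. j < card Z div 2 \<and> E \<in> greedy Z j \<and> E \<subseteq> edges f Z \<and> indep K E
    \<and> \<not> indep K (insert {pick (Z - \<Union>E), f (pick (Z - \<Union>E))} E)"
  proof (rule ccontr)
    assume neg: "\<not> ?thesis"
    have "\<exists>E\<in>greedy Z j. E \<subseteq> edges f Z \<and> indep K E" if "j \<le> card Z div 2" for j
      using that
    proof (induction j)
      case 0
      then show ?case by (auto simp: indep_def)
    next
      case (Suc j)
      then obtain E where E: "E \<in> greedy Z j" "E \<subseteq> edges f Z" "indep K E" by auto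
      have ne: "\<Union>E \<noteq> Z" using Suc.prems by (intro greedy_Union_ne[OF assms(1) E(1)]) auto
      have "indep K (insert {pick (Z - \<Union>E), f (pick (Z - \<Union>E))} E)"
        using neg Suc.prems E by (meson Suc_le_eq)
      with greedy_extend(3,4)[OF assms(1,2) E(1,2) ne] show ?case by blast
    qed
    from this[of "card Z div 2"] obtain E
      where E: "E \<in> greedy Z (card Z div 2)" "E \<subseteq> edges f Z" "indep K E" by auto
    have "E = edges f Z" by (rule greedy_full[OF assms(1,2) E(1,2)])
    then have "\<Union>E = Z" using Union_edges[OF assms(2)] by simp
    moreover have "E \<noteq> {}" using calculation assms(4) by auto
    ultimately show False using E(3) assms(3) unfolding indep_def by blast
  qed
  then obtain j E where j: "j < card Z div 2" and E: "E \<in> greedy Z j" "E \<subseteq> edges f Z" "indep K E"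
    and ni: "\<not> indep K (insert {pick (Z - \<Union>E), f (pick (Z - \<Union>E))} E)" by blast
  define p where "p = pick (Z - \<Union>E)"
  have ne: "\<Union>E \<noteq> Z" using j by (intro greedy_Union_ne[OF assms(1) E(1)]) auto
  note ext = greedy_extend[OF assms(1,2) E(1,2) ne, folded p_def]
  from ni obtain F where F: "F \<subseteq> insert {p, f p} E" "F \<noteq> {}" "\<Union>F \<in> K"
    unfolding indep_def p_def by auto
  have inF: "{p, f p} \<in> F"
  proof (rule ccontr)
    assume "{p, f p} \<notin> F"
    then have "F \<subseteq> E" using F by auto
    then show False using E(3) F unfolding indep_def by auto
  qed
  define E' where "E' = F - {{p, f p}}"
  have "E' \<subseteq> E" using F unfolding E'_def by auto
  have UF: "\<Union>F = {p, f p} \<union> \<Union>E'" using inF unfolding E'_def by auto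
  have "E' \<noteq> {}"
  proof
    assume "E' = {}"
    then have "{p, f p} \<in> K" using UF F by simp
    moreover have "{p, f p} \<notin> K" using ext by (intro pairs) auto
    ultimately show False by simp
  qed
  have "j \<noteq> 0" using \<open>E' \<subseteq> E\<close> \<open>E' \<noteq> {}\<close> E(1) by (cases j) auto
  moreover have "\<exists>y\<in>Z - \<Union>E - {p}. {p, y} \<union> \<Union>E' \<in> K"
    using ext(2) UF F(3) by (intro bexI[of _ "f p"]) simp_all
  ultimately show ?thesis
    using j E \<open>E' \<subseteq> E\<close> \<open>E' \<noteq> {}\<close> unfolding p_def by blast
qed

text \<open>Binomial expansion of \<open>(2 + 1) ^ card E\<close>. The weight
  \<open>2 ^ (card E' - 1)\<close> is the recursive bound \<open>2 ^ (m - 2)\<close> for the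
  \<open>2 * m\<close> keys made of the pairs in \<open>E'\<close> and one further pair.\<close>

lemma sum_pow_nonempty_subsets:
  assumes "finite E"
  shows "(\<Sum>E'\<in>Pow E - {{}}. (2::real) ^ (card E' - 1)) = (3 ^ card E - 1) / 2"
proof -
  have "(\<Sum>E'\<in>Pow E. (2::real) ^ card E') = (\<Prod>x\<in>E. 2 + 1)"
    using assms by (subst prod_add) simp_all
  then have a: "(\<Sum>E'\<in>Pow E. (2::real) ^ card E') = 3 ^ card E" by simp
  have "(\<Sum>E'\<in>Pow E - {{}}. (2::real) ^ card E') = 3 ^ card E - 1"
    using assms a by (simp add: sum_diff)
  moreover have "(\<Sum>E'\<in>Pow E - {{}}. (2::real) ^ card E')
      = (\<Sum>E'\<in>Pow E - {{}}. 2 * (2::real) ^ (card E' - 1))"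
  proof (rule sum.cong)
    fix F assume "F \<in> Pow E - {{}}"
    then have "card F > 0" using assms by (auto simp: card_gt_0_iff intro: finite_subset)
    then show "(2::real) ^ card F = 2 * 2 ^ (card F - 1)"
      by (metis Suc_diff_1 power_Suc)
  qed simp
  ultimately show ?thesis by (simp add: sum_distrib_left[symmetric])
qed

text \<open>Two points with equal value are paired off and removed, which lowers one fibre by two
  and keeps all parities.\<close>

lemma pairing_of_even_fibres:
  assumes "finite Z" "\<And>a. even (card {x\<in>Z. D x = a})"
  shows "\<exists>f. pairing f Z \<and> (\<forall>x\<in>Z. D (f x) = D x)"
  using assms
proof (induction "card Z" arbitrary: Z rule: less_induct)
  case less
  show ?case
  proof (cases "Z = {}")
    case True
    then show ?thesis by (simp add: pairing_def)
  next
    case False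
    then obtain z where z: "z \<in> Z" by auto
    let ?F = "{x\<in>Z. D x = D z}"
    have "even (card ?F)" "z \<in> ?F" "finite ?F" using less.prems z by auto
    moreover have "?F \<noteq> {z}"
    proof
      assume "?F = {z}"
      then have "card ?F = 1" by simp
      with \<open>even (card ?F)\<close> show False by simp
    qed
    ultimately obtain y where y: "y \<in> Z" "D y = D z" "y \<noteq> z" by auto
    define Y where "Y = Z - {z, y}"
    have "card Y < card Z" unfolding Y_def using z less.prems(1) by (intro psubset_card_mono) auto
    moreover have "finite Y" unfolding Y_def using less.prems by auto
    moreover have "even (card {x\<in>Y. D x = a})" for a
    proof (cases "a = D z")
      case True
      have "{x\<in>Y. D x = a} = ?F - {z, y}" unfolding Y_def True by auto
      moreover have "card (?F - {z, y}) = card ?F - 2"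
        using y z less.prems(1) by (subst card_Diff_subset) auto
      ultimately show ?thesis using \<open>even (card ?F)\<close> by simp
    next
      case False
      then have "{x\<in>Y. D x = a} = {x\<in>Z. D x = a}" unfolding Y_def using y by auto
      then show ?thesis using less.prems(2) by simp
    qed
    ultimately obtain f where f: "pairing f Y" "\<forall>x\<in>Y. D (f x) = D x" using less.hyps by blast
    have "pairing (f(z := y, y := z)) Z" "\<forall>x\<in>Z. D ((f(z := y, y := z)) x) = D x"
      using f y z unfolding pairing_def Y_def by auto
    then show ?thesis by blast
  qed
qed

section \<open>Alternating structures of two perfect matchings\<close>

definition linked :: "'a set set \<Rightarrow> ('a \<Rightarrow> 'a) \<Rightarrow> 'a set \<Rightarrow> bool" where
  "linked K f A \<longleftrightarrow> (\<exists>B\<subseteq>A. B \<noteq> {} \<and> f ` B \<subseteq> B \<and> B \<in> K)"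

text \<open>The set \<^term>\<open>U\<close> is a path together with cycles of the union of the two pairings, with the last
  point \<^term>\<open>f \<alpha>\<close> (or \<^term>\<open>g \<gamma>\<close>) of the path left out.\<close>
definition nearly_closed ::
  "'a set \<Rightarrow> ('a \<Rightarrow> 'a) \<Rightarrow> ('a \<Rightarrow> 'a) \<Rightarrow> 'a set \<Rightarrow> 'a \<Rightarrow> 'a \<Rightarrow> bool" where
  "nearly_closed Z f g U \<alpha> \<gamma> \<longleftrightarrow> U \<subseteq> Z \<and> \<alpha> \<in> U \<and> \<gamma> \<in> U \<and> f ` (U - {\<alpha>}) \<subseteq> U - {\<alpha>}
     \<and> g ` (U - {\<gamma>}) \<subseteq> U - {\<gamma>} \<and> f \<alpha> \<notin> U \<and> g \<gamma> \<notin> U"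

text \<open>Removing \<open>\<alpha>\<close> and a second point \<open>z\<close> gives a smaller
  structure whose completion by \<open>f\<close> is the old \<open>U - {\<alpha>}\<close>. If
  \<open>\<gamma> \<noteq> \<alpha>\<close>, then \<open>z\<close> is the neighbour
  \<open>g \<alpha>\<close> on the path. If the path is the single point \<open>\<alpha>\<close>,
  removing \<open>z\<close> opens a cycle into a new path with ends \<open>f z\<close> and
  \<open>g z\<close>.\<close>

lemma nearly_closed_shrink:
  assumes "finite Z" and f: "pairing f Z" and g: "pairing g Z"
    and U: "nearly_closed Z f g U \<alpha> \<gamma>" and dep: "linked K f (U - {\<alpha>})"
  shows "\<exists>U' \<alpha>' \<gamma>'. card U' < card U \<and> nearly_closed Z f g U' \<alpha>' \<gamma>'
    \<and> linked K f (insert (f \<alpha>') U')"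
proof -
  have finU: "finite U" using U assms(1) unfolding nearly_closed_def by (auto intro: finite_subset)
  have fU: "f x \<in> U - {\<alpha>} \<and> f x \<noteq> x \<and> f (f x) = x" if "x \<in> U - {\<alpha>}" for x
    using that U f unfolding nearly_closed_def pairing_def by blast
  have gU: "g x \<in> U - {\<gamma>} \<and> g x \<noteq> x \<and> g (g x) = x" if "x \<in> U - {\<gamma>}" for x
    using that U g unfolding nearly_closed_def pairing_def by blast
  have UZ: "U \<subseteq> Z" "\<alpha> \<in> U" "\<gamma> \<in> U" "g \<gamma> \<notin> U" using U unfolding nearly_closed_def by auto
  obtain z where z: "z \<in> U - {\<alpha>}" and zg: "\<gamma> \<noteq> \<alpha> \<longrightarrow> z = g \<alpha>"
  proof (cases "\<gamma> = \<alpha>")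
    case True
    then show ?thesis using dep that unfolding linked_def by blast
  next
    case False
    then show ?thesis using gU[of \<alpha>] UZ that by auto
  qed
  define U' where "U' = U - {\<alpha>, z}"
  define \<gamma>' where "\<gamma>' = (if \<gamma> = \<alpha> then g z else \<gamma>)"
  have "card U' < card U" unfolding U'_def using UZ finU by (intro psubset_card_mono) auto
  moreover have "nearly_closed Z f g U' (f z) \<gamma>'"
  proof -
    have "f z \<in> U'" using fU[OF z] unfolding U'_def by auto
    moreover have "f ` (U' - {f z}) \<subseteq> U' - {f z}"
    proof
      fix y assume "y \<in> f ` (U' - {f z})"
      then obtain x where x: "x \<in> U" "x \<noteq> \<alpha>" "x \<noteq> z" "x \<noteq> f z" "y = f x" unfolding U'_def by auto
      then have fx: "f x \<in> U - {\<alpha>}" "f (f x) = x" using fU[of x] by auto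
      have "f x \<noteq> z" using fx(2) x(4) by auto
      moreover have "f x \<noteq> f z" using fx(2) fU[OF z] x(3) by metis
      ultimately show "y \<in> U' - {f z}" using fx x unfolding U'_def by auto
    qed
    moreover have "f (f z) \<notin> U'" using fU[OF z] unfolding U'_def by auto
    moreover have "\<gamma>' \<in> U' \<and> g ` (U' - {\<gamma>'}) \<subseteq> U' - {\<gamma>'} \<and> g \<gamma>' \<notin> U'"
    proof (cases "\<gamma> = \<alpha>")
      case True
      then have gz: "g z \<in> U - {\<alpha>}" "g z \<noteq> z" "g (g z) = z" using gU[of z] z by auto
      have "g ` (U' - {g z}) \<subseteq> U' - {g z}"
      proof
        fix y assume "y \<in> g ` (U' - {g z})"
        then obtain x where x: "x \<in> U" "x \<noteq> \<alpha>" "x \<noteq> z" "x \<noteq> g z" "y = g x" unfolding U'_def by auto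
        then have fx: "g x \<in> U - {\<alpha>}" "g (g x) = x" using gU[of x] True by auto
        have "g x \<noteq> z" using fx(2) x(4) by auto
        moreover have "g x \<noteq> g z" using fx(2) gz x(3) by metis
        ultimately show "y \<in> U' - {g z}" using fx x unfolding U'_def by auto
      qed
      then show ?thesis using True gz unfolding \<gamma>'_def U'_def by auto
    next
      case False
      then have zz: "z = g \<alpha>" using zg by simp
      have ga: "z \<in> U - {\<gamma>}" "g z = \<alpha>" using gU[of \<alpha>] False UZ unfolding zz by auto
      have "g ` (U' - {\<gamma>}) \<subseteq> U' - {\<gamma>}"
      proof
        fix y assume "y \<in> g ` (U' - {\<gamma>})"
        then obtain x where x: "x \<in> U" "x \<noteq> \<alpha>" "x \<noteq> z" "x \<noteq> \<gamma>" "y = g x" unfolding U'_def by auto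
        then have fx: "g x \<in> U - {\<gamma>}" "g (g x) = x" using gU[of x] by auto
        have "g x \<noteq> z" using fx(2) x(2) ga by auto
        moreover have "g x \<noteq> \<alpha>" using fx(2) zz x(3) by metis
        ultimately show "y \<in> U' - {\<gamma>}" using fx x unfolding U'_def by auto
      qed
      then show ?thesis using False ga UZ unfolding \<gamma>'_def U'_def by auto
    qed
    ultimately show ?thesis using UZ unfolding nearly_closed_def U'_def by auto
  qed
  moreover have "insert (f (f z)) U' = U - {\<alpha>}" using fU[OF z] z unfolding U'_def by auto
  then have "linked K f (insert (f (f z)) U')" using dep by simp
  ultimately show ?thesis by blast
qed

lemma nearly_closed_swap: "nearly_closed Z f g U \<alpha> \<gamma> \<longleftrightarrow> nearly_closed Z g f U \<gamma> \<alpha>"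
  unfolding nearly_closed_def by auto

text \<open>Take a structure of least cardinality among those with a dependent completion;
  \<open>Z\<close> without one point is such a structure. A dependence already present in
  \<open>U - {\<alpha>}\<close> or \<open>U - {\<gamma>}\<close> would give a smaller one.\<close>

lemma minimal_nearly_closed:
  assumes "finite Z" and f: "pairing f Z" and g: "pairing g Z" and "Z \<in> K" "Z \<noteq> {}"
  shows "\<exists>U \<alpha> \<gamma>. nearly_closed Z f g U \<alpha> \<gamma> \<and> \<not> linked K f (U - {\<alpha>}) \<and> \<not> linked K g (U - {\<gamma>})
    \<and> (linked K f (insert (f \<alpha>) U) \<or> linked K g (insert (g \<gamma>) U))"
proof -
  define bad where "bad U \<longleftrightarrow> (\<exists>\<alpha> \<gamma>. nearly_closed Z f g U \<alpha> \<gamma> \<and>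
    (linked K f (insert (f \<alpha>) U) \<or> linked K g (insert (g \<gamma>) U)))" for U
  obtain z where z: "z \<in> Z" using assms(5) by auto
  have fz: "f z \<in> Z" "f z \<noteq> z" "f (f z) = z" and gz: "g z \<in> Z" "g z \<noteq> z" "g (g z) = z"
    using z f g unfolding pairing_def by auto
  have cl: "h ` (Z - {z} - {h z}) \<subseteq> Z - {z} - {h z}" if h: "pairing h Z" for h
  proof
    fix y assume "y \<in> h ` (Z - {z} - {h z})"
    then obtain x where x: "x \<in> Z" "x \<noteq> z" "x \<noteq> h z" "y = h x" by auto
    have "h x \<in> Z" "h (h x) = x" "h (h z) = z" using h x z unfolding pairing_def by auto
    then show "y \<in> Z - {z} - {h z}" using x by force
  qed
  \<comment> \<open>Dropping \<open>z\<close> leaves \<open>f z\<close> and \<open>g z\<close> as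
    the ends, each with the missing partner \<open>z\<close>.\<close>
  have "nearly_closed Z f g (Z - {z}) (f z) (g z)"
    unfolding nearly_closed_def using fz gz cl[OF f] cl[OF g] by auto
  moreover have "insert (f (f z)) (Z - {z}) = Z" using fz z by auto
  moreover have "linked K f Z" using f assms(4,5) unfolding linked_def pairing_def by blast
  ultimately have "bad (Z - {z})" unfolding bad_def by metis
  then obtain U where U: "bad U" and min: "\<And>V. bad V \<Longrightarrow> card U \<le> card V"
    using ex_has_least_nat[of bad "Z - {z}" card] by blast
  then obtain \<alpha> \<gamma> where ab: "nearly_closed Z f g U \<alpha> \<gamma>"
    "linked K f (insert (f \<alpha>) U) \<or> linked K g (insert (g \<gamma>) U)" unfolding bad_def by blast
  have "\<not> linked K f (U - {\<alpha>})"
  proof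
    assume "linked K f (U - {\<alpha>})"
    from nearly_closed_shrink[OF assms(1) f g ab(1) this] show False
      using min unfolding bad_def by (meson not_less)
  qed
  moreover have "\<not> linked K g (U - {\<gamma>})"
  proof
    assume "linked K g (U - {\<gamma>})"
    from nearly_closed_shrink[OF assms(1) g f ab(1)[unfolded nearly_closed_swap[of Z f]] this]
    show False
      using min unfolding bad_def by (meson not_less nearly_closed_swap)
  qed
  ultimately show ?thesis using ab by blast
qed

text \<open>A union of edges is closed under \<open>f\<close>, so a dependent one would witness
  \<open>linked\<close>.\<close>

lemma indep_edges:
  assumes "pairing f A" "\<not> linked K f A" shows "indep K (edges f A)"
  unfolding indep_def
proof (intro allI impI notI)
  fix E assume E: "E \<subseteq> edges f A" "E \<noteq> {}" "\<Union>E \<in> K"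
  have "\<Union>E \<subseteq> A" using E(1) Union_edges[OF assms(1)] by blast
  moreover have "\<Union>E \<noteq> {}" using E(1,2) unfolding edges_def by blast
  moreover have "f ` \<Union>E \<subseteq> \<Union>E"
  proof
    fix y assume "y \<in> f ` \<Union>E"
    then obtain x e where x: "y = f x" "x \<in> e" "e \<in> E" by auto
    then obtain z where z: "z \<in> A" "e = {z, f z}" using E(1) unfolding edges_def by auto
    have "f (f z) = z" using assms(1) z unfolding pairing_def by auto
    then have "y \<in> e" using x z by auto
    then show "y \<in> \<Union>E" using x by auto
  qed
  ultimately show False using assms(2) E(3) unfolding linked_def by blast
qed

text \<open>A dependent closed subset of the completion must use \<open>\<alpha>\<close> and
  \<open>f \<alpha>\<close>, since \<open>U - {\<alpha>}\<close> contains none. What it has besides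
  these two is a union of edges, nonempty because a pair is never dependent. The point
  \<open>f \<alpha>\<close> survives only as some \<open>v\<close> outside \<open>U\<close>.\<close>

lemma nearly_closed_obstruction:
  assumes f: "pairing f Z" and U: "nearly_closed Z f g U \<alpha> \<gamma>"
    and ni: "\<not> linked K f (U - {\<alpha>})" and dep: "linked K f (insert (f \<alpha>) U)"
    and pairs: "\<And>x y. x \<in> Z \<Longrightarrow> y \<in> Z \<Longrightarrow> x \<noteq> y \<Longrightarrow> {x, y} \<notin> K"
  shows "\<exists>E'\<subseteq>edges f (U - {\<alpha>}). E' \<noteq> {} \<and> (\<exists>v\<in>Z - U. insert v (insert \<alpha> (\<Union>E')) \<in> K)"
proof -
  have aZ: "\<alpha> \<in> U" "U \<subseteq> Z" "f \<alpha> \<notin> U" using U unfolding nearly_closed_def by auto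
  then have fa: "f \<alpha> \<in> Z" "f \<alpha> \<noteq> \<alpha>" "f (f \<alpha>) = \<alpha>" using f unfolding pairing_def by auto
  obtain B where B: "B \<subseteq> insert (f \<alpha>) U" "B \<noteq> {}" "f ` B \<subseteq> B" "B \<in> K"
    using dep unfolding linked_def by auto
  have "\<alpha> \<in> B"
  proof (rule ccontr)
    assume "\<alpha> \<notin> B"
    moreover from this have "f \<alpha> \<notin> B" using B(3) fa(3) by force
    ultimately have "B \<subseteq> U - {\<alpha>}" using B(1) by auto
    then show False using ni B unfolding linked_def by blast
  qed
  then have faB: "f \<alpha> \<in> B" using B(3) by auto
  define P where "P = B - {\<alpha>, f \<alpha>}"
  have PU: "P \<subseteq> U - {\<alpha>}" using B(1) unfolding P_def by auto
  have pP: "pairing f P"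
    unfolding pairing_def
  proof
    fix x assume x: "x \<in> P"
    then have "x \<in> Z" using PU aZ by auto
    then have fx: "f x \<noteq> x" "f (f x) = x" using f unfolding pairing_def by auto
    have "f x \<noteq> \<alpha>" "f x \<noteq> f \<alpha>" using x fx fa unfolding P_def by auto
    moreover have "f x \<in> B" using x B(3) unfolding P_def by auto
    ultimately show "f x \<in> P \<and> f x \<noteq> x \<and> f (f x) = x" using fx unfolding P_def by auto
  qed
  have BP: "insert (f \<alpha>) (insert \<alpha> (\<Union>(edges f P))) = B"
    using Union_edges[OF pP] \<open>\<alpha> \<in> B\<close> faB unfolding P_def by auto
  have "edges f P \<noteq> {}"
  proof
    assume "edges f P = {}"
    then have "{f \<alpha>, \<alpha>} \<in> K" using BP B(4) by simp
    then show False using pairs[of "f \<alpha>" \<alpha>] fa aZ by auto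
  qed
  moreover have "edges f P \<subseteq> edges f (U - {\<alpha>})" using PU unfolding edges_def by auto
  moreover have "f \<alpha> \<in> Z - U" using fa aZ by auto
  ultimately show ?thesis using BP B(4) by blast
qed

text \<open>\<open>nearly_closed\<close> is symmetric under exchanging the pairings together with
  the two ends, so \<open>h\<close> can be the pairing whose completion is dependent.\<close>

lemma obstruction_exists:
  assumes "finite Z" and f: "pairing f Z" and g: "pairing g Z" and "Z \<in> K" "Z \<noteq> {}"
    and pairs: "\<forall>x\<in>Z. \<forall>y\<in>Z. x \<noteq> y \<longrightarrow> {x, y} \<notin> K"
  shows "\<exists>h h' U \<alpha> \<gamma>. (h = f \<and> h' = g \<or> h = g \<and> h' = f) \<and> U \<subseteq> Z \<and> \<alpha> \<in> U \<and> \<gamma> \<in> U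
    \<and> pairing h (U - {\<alpha>}) \<and> pairing h' (U - {\<gamma>})
    \<and> indep K (edges h (U - {\<alpha>})) \<and> indep K (edges h' (U - {\<gamma>}))
    \<and> (\<exists>E'\<subseteq>edges h (U - {\<alpha>}). E' \<noteq> {} \<and> (\<exists>v\<in>Z - U. insert v (insert \<alpha> (\<Union>E')) \<in> K))"
proof -
  obtain U \<alpha> \<gamma> where U: "nearly_closed Z f g U \<alpha> \<gamma>"
    and ni: "\<not> linked K f (U - {\<alpha>})" "\<not> linked K g (U - {\<gamma>})"
    and dep: "linked K f (insert (f \<alpha>) U) \<or> linked K g (insert (g \<gamma>) U)"
    using minimal_nearly_closed[OF assms(1-5)] by blast
  have U': "nearly_closed Z g f U \<gamma> \<alpha>" using U nearly_closed_swap by metis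
  have p: "pairing f (U - {\<alpha>})" "pairing g (U - {\<gamma>})"
    using U f g unfolding nearly_closed_def pairing_def by blast+
  note ind = indep_edges[OF p(1) ni(1)] indep_edges[OF p(2) ni(2)]
  have UZ: "U \<subseteq> Z" "\<alpha> \<in> U" "\<gamma> \<in> U" using U unfolding nearly_closed_def by auto
  from dep show ?thesis
  proof
    assume "linked K f (insert (f \<alpha>) U)"
    from nearly_closed_obstruction[OF f U ni(1) this pairs[rule_format]] show ?thesis
      using p ind UZ by blast
  next
    assume "linked K g (insert (g \<gamma>) U)"
    from nearly_closed_obstruction[OF g U' ni(2) this pairs[rule_format]] show ?thesis
      using p ind UZ by blast
  qed
qed

section \<open>Probability of a dependent set\<close>

definition dens :: "'w set \<Rightarrow> ('w \<Rightarrow> bool) \<Rightarrow> real" where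
  "dens \<Omega> P = real (card {w\<in>\<Omega>. P w}) / real (card \<Omega>)"

lemma dens_mono:
  assumes "finite \<Omega>" "\<And>w. w \<in> \<Omega> \<Longrightarrow> P w \<Longrightarrow> Q w"
  shows "dens \<Omega> P \<le> dens \<Omega> Q"
  unfolding dens_def using assms
  by (intro divide_right_mono of_nat_mono card_mono) auto

lemma dens_le_1: "finite \<Omega> \<Longrightarrow> dens \<Omega> P \<le> 1"
  using card_mono[of \<Omega> "{w\<in>\<Omega>. P w}"] unfolding dens_def by (auto simp: divide_le_eq_1)

lemma dens_Bex_le:
  assumes "finite \<Omega>" "finite I"
  shows "dens \<Omega> (\<lambda>w. \<exists>i\<in>I. P i w) \<le> (\<Sum>i\<in>I. dens \<Omega> (P i))"
proof -
  have "card {w\<in>\<Omega>. \<exists>i\<in>I. P i w} = card (\<Union>i\<in>I. {w\<in>\<Omega>. P i w})"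
    by (rule arg_cong[of _ _ card]) auto
  also have "\<dots> \<le> (\<Sum>i\<in>I. card {w\<in>\<Omega>. P i w})" using assms(2) by (rule card_UN_le)
  finally have "real (card {w\<in>\<Omega>. \<exists>i\<in>I. P i w}) \<le> (\<Sum>i\<in>I. real (card {w\<in>\<Omega>. P i w}))"
    by (simp flip: of_nat_sum)
  then show ?thesis unfolding dens_def sum_divide_distrib[symmetric] by (rule divide_right_mono) simp
qed

lemma dens_Bex_le_mult:
  assumes "finite \<Omega>" "finite I" "\<And>i. i \<in> I \<Longrightarrow> dens \<Omega> (P i) \<le> b" "real (card I) \<le> m" "0 \<le> b"
  shows "dens \<Omega> (\<lambda>w. \<exists>i\<in>I. P i w) \<le> m * b"
proof -
  have "dens \<Omega> (\<lambda>w. \<exists>i\<in>I. P i w) \<le> (\<Sum>i\<in>I. dens \<Omega> (P i))" by (rule dens_Bex_le[OF assms(1,2)])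
  also have "\<dots> \<le> card I * b" using sum_bounded_above[of I "\<lambda>i. dens \<Omega> (P i)" b] assms(3) by simp
  also have "\<dots> \<le> m * b" using assms(4,5) by (rule mult_right_mono)
  finally show ?thesis .
qed

section \<open>Numerical estimates for the recursion over the levels\<close>

lemma geometric_sum_le:
  fixes q :: real
  assumes "0 \<le> q" "q < 1"
  shows "(\<Sum>j<n. q ^ j) \<le> 1 / (1 - q)"
  using assms by (simp add: sum_gp_strict divide_right_mono)

text \<open>Each step at most doubles the left side. The induction cannot start earlier: the
  inequality fails at 15.\<close>

lemma linear_times_pow_le: "16 \<le> m \<Longrightarrow> (2 * real m - 1) * (3/2) ^ (m - 1) \<le> 2 ^ (m - 2)"
proof (induction m rule: nat_induct_at_least)
  case base
  show ?case by (simp add: power_divide)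
next
  case (Suc m)
  have e: "Suc m - 1 = Suc (m - 1)" "Suc m - 2 = Suc (m - 2)" using Suc.hyps by auto
  have "(2 * real (Suc m) - 1) * (3/2) ^ (Suc m - 1) = ((2 * real m + 1) * (3/2)) * (3/2) ^ (m - 1)"
    unfolding e by simp
  also have "\<dots> \<le> (2 * (2 * real m - 1)) * (3/2) ^ (m - 1)"
    using Suc.hyps by (intro mult_right_mono) auto
  also have "\<dots> = 2 * ((2 * real m - 1) * (3/2) ^ (m - 1))" by simp
  also have "\<dots> \<le> 2 * 2 ^ (m - 2)" using Suc.IH by simp
  finally show ?case unfolding e by simp
qed

lemma linear_le_pow: "5 \<le> m \<Longrightarrow> (2 * real m - 1) * (12/5) \<le> 3 * 2 ^ (m - 2)"
proof (induction m rule: nat_induct_at_least)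
  case (Suc m)
  have e: "Suc m - 2 = Suc (m - 2)" using Suc.hyps by auto
  have "(2 * real (Suc m) - 1) * (12/5) \<le> 2 * ((2 * real m - 1) * (12/5))" using Suc.hyps by auto
  then show ?case unfolding e using Suc.IH by simp
qed simp

text \<open>The first pair contributes \<open>(2 * m - 1) / N\<close> and each later one at most
  \<open>r\<close>, so the sum is dominated by a geometric series of ratio \<open>3 * r\<close>. As
  \<open>r \<le> 1/2\<close>, its growth of order \<open>(3/2) ^ m\<close> loses against
  \<open>2 ^ (m - 2)\<close> for large \<open>m\<close>; for \<open>m\<close> from 3 to 15,
  \<open>256 \<le> N\<close> makes \<open>r\<close> small.\<close>

lemma greedy_weight_le:
  fixes N :: real
  assumes "2 \<le> m" "4 * real m \<le> N" "256 \<le> N"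
  shows "(\<Sum>j=1..<m. real (\<Prod>l<j. 2 * m - 1 - 2 * l) * ((3 ^ j - 1) / 2) / N ^ j) \<le> 2 ^ (m - 2) * (3 / N)"
proof -
  define r where "r = (2 * real m - 3) / N"
  have N: "N > 0" using assms by simp
  have r0: "0 \<le> r" unfolding r_def using assms by simp
  have P: "real (\<Prod>l<j. 2 * m - 1 - 2 * l) / N ^ j \<le> (2 * real m - 1) / N * r ^ (j - 1)"
    if "1 \<le> j" for j
    using that
  proof (induction j rule: nat_induct_at_least)
    case base
    show ?case using assms by (simp add: of_nat_diff)
  next
    case (Suc j)
    have "real (\<Prod>l<Suc j. 2 * m - 1 - 2 * l) / N ^ Suc j
        = (real (\<Prod>l<j. 2 * m - 1 - 2 * l) / N ^ j) * (real (2 * m - 1 - 2 * j) / N)"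
      by simp
    also have "\<dots> \<le> ((2 * real m - 1) / N * r ^ (j - 1)) * r"
    proof (rule mult_mono)
      have "real (2 * m - 1 - 2 * j) \<le> 2 * real m - 3" using Suc.hyps assms(1) by linarith
      then show "real (2 * m - 1 - 2 * j) / N \<le> r" unfolding r_def using N by (simp add: divide_right_mono)
      show "0 \<le> (2 * real m - 1) / N * r ^ (j - 1)" using r0 assms N by simp
    qed (use Suc N in auto)
    also have "\<dots> = (2 * real m - 1) / N * r ^ (Suc j - 1)"
      using Suc.hyps by (cases j) auto
    finally show ?case .
  qed
  define W where "W = (\<Sum>j=1..<m. r ^ (j - 1) * ((3 ^ j - 1) / 2))"
  have "(\<Sum>j=1..<m. real (\<Prod>l<j. 2 * m - 1 - 2 * l) * ((3 ^ j - 1) / 2) / N ^ j)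
      \<le> (\<Sum>j=1..<m. (2 * real m - 1) / N * (r ^ (j - 1) * ((3 ^ j - 1) / 2)))"
  proof (rule sum_mono)
    fix j assume "j \<in> {1..<m}"
    then have "real (\<Prod>l<j. 2 * m - 1 - 2 * l) / N ^ j * ((3 ^ j - 1) / 2)
      \<le> (2 * real m - 1) / N * r ^ (j - 1) * ((3 ^ j - 1) / 2)"
      using P[of j] by (intro mult_right_mono) auto
    then show "real (\<Prod>l<j. 2 * m - 1 - 2 * l) * ((3 ^ j - 1) / 2) / N ^ j
      \<le> (2 * real m - 1) / N * (r ^ (j - 1) * ((3 ^ j - 1) / 2))"
      by (simp add: mult_ac)
  qed
  also have "\<dots> = (2 * real m - 1) * W / N" unfolding W_def sum_distrib_left[symmetric] by simp
  also have "\<dots> \<le> 3 * 2 ^ (m - 2) / N"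
  proof (rule divide_right_mono)
    have W_le: "W \<le> 3/2 * (\<Sum>j<m - 1. (3 * r) ^ j)"
    proof -
      have "W = (\<Sum>j<m - 1. r ^ j * ((3 ^ Suc j - 1) / 2))"
        unfolding W_def by (rule sum.reindex_bij_witness[of _ Suc "\<lambda>j. j - 1"]) auto
      also have "\<dots> \<le> (\<Sum>j<m - 1. 3/2 * (3 * r) ^ j)"
        using r0 by (intro sum_mono) (simp add: power_mult_distrib field_simps)
      finally show ?thesis by (simp add: sum_distrib_left)
    qed
    consider "m = 2" | "m = 3" | "m = 4" | "5 \<le> m" "m < 16" | "16 \<le> m" using assms(1) by linarith
    then show "(2 * real m - 1) * W \<le> 3 * 2 ^ (m - 2)"
    proof cases
      \<comment> \<open>Equality holds here: four keys have three perfect matchings, which fixes the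
        constant 3 in \<open>3 / N\<close>.\<close>
      case 1
      have "{1..<2} = {1::nat}" by auto
      then show ?thesis unfolding W_def 1 by simp
    next
      case 2
      then have "r \<le> 3/256" unfolding r_def using assms by (simp add: field_simps)
      moreover have "{1..<3} = {1, 2::nat}" by auto
      ultimately show ?thesis unfolding W_def 2 by simp
    next
      case 3
      then have r1: "r \<le> 5/256" unfolding r_def using assms by (simp add: field_simps)
      then have "r\<^sup>2 \<le> (5/256)\<^sup>2" using r0 by (intro power_mono) auto
      moreover have "{1..<4} = {1, 2, 3::nat}" by auto
      ultimately show ?thesis unfolding W_def 3 using r1 by (simp add: power_divide)
    next
      case 4
      \<comment> \<open>\<open>2 * m - 3\<close> is at most 27, and 27/256 is below 1/8; the ratio
        of the series is then at most 3/8.\<close>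
      then have "r \<le> 1/8" unfolding r_def using assms by (simp add: field_simps)
      then have "(\<Sum>j<m - 1. (3 * r) ^ j) \<le> (\<Sum>j<m - 1. (3/8) ^ j)"
        using r0 by (intro sum_mono power_mono) auto
      also have "\<dots> \<le> 8/5" using geometric_sum_le[of "3/8"] by simp
      finally have "W \<le> 12/5" using W_le by simp
      then have "(2 * real m - 1) * W \<le> (2 * real m - 1) * (12/5)" using 4 by (intro mult_left_mono) auto
      then show ?thesis using linear_le_pow[OF 4(1)] by linarith
    next
      case 5
      \<comment> \<open>\<open>4 * real m \<le> N\<close> gives ratio at most 3/2, so the sum grows
        but stays below \<open>2 * (3/2) ^ (m - 1)\<close>.\<close>
      have "r \<le> 1/2" unfolding r_def using assms by (simp add: field_simps)
      then have "(\<Sum>j<m - 1. (3 * r) ^ j) \<le> (\<Sum>j<m - 1. (3/2) ^ j)"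
        using r0 by (intro sum_mono power_mono) auto
      also have "\<dots> \<le> 2 * (3/2) ^ (m - 1)" by (simp add: sum_gp_strict)
      finally have "W \<le> 3 * (3/2) ^ (m - 1)" using W_le by simp
      then have "(2 * real m - 1) * W \<le> (2 * real m - 1) * (3 * (3/2) ^ (m - 1))"
        using 5 by (intro mult_left_mono) auto
      then show ?thesis using linear_times_pow_le[OF 5] by linarith
    qed
  qed (use N in simp)
  also have "\<dots> = 2 ^ (m - 2) * (3 / N)" by simp
  finally show ?thesis .
qed

text \<open>\<^term>\<open>\<Omega>\<close> is the space of all tables, \<^term>\<open>same i\<close> says that two outcomes agree on the tables of
  the levels below \<^term>\<open>i\<close>, and \<^term>\<open>Ker i\<close> collects the sets of keys that are linearly dependent in
  the characters below level \<^term>\<open>i\<close>. Assumption \<open>level\<close> is the independence of the tables: a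
  matching that is independent at level \<^term>\<open>i\<close> is realised with probability at most
  \<open>1 / N\<close> per pair.\<close>
locale kernel_levels =
  fixes \<Omega> :: "'w set" and same :: "nat \<Rightarrow> 'w \<Rightarrow> 'w \<Rightarrow> bool" and X :: "'x set"
    and Ker :: "nat \<Rightarrow> 'w \<Rightarrow> 'x set set" and K0 :: "'x set set"
    and D :: "nat \<Rightarrow> 'w \<Rightarrow> 'x \<Rightarrow> 'v" and N :: real and d :: nat
  assumes finite_Omega: "finite \<Omega>" and finite_X: "finite X"
    and N_ge: "256 \<le> N" and card_X: "2 * real (card X) \<le> N" and d_ge: "1 \<le> d"
    and same_Suc: "same (Suc i) w w' \<Longrightarrow> same i w w'"
    and Ker_same: "same i w w' \<Longrightarrow> Ker i w = Ker i w'"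
    and D_same: "same (Suc i) w w' \<Longrightarrow> D i w = D i w'"
    and Ker_0: "Ker 0 w = K0"
    and Ker_Suc: "w \<in> \<Omega> \<Longrightarrow> Z \<subseteq> X \<Longrightarrow> Z \<in> Ker (Suc i) w \<Longrightarrow> Z \<in> Ker i w"
    and even_fibres: "w \<in> \<Omega> \<Longrightarrow> Z \<subseteq> X \<Longrightarrow> Z \<in> Ker (Suc i) w \<Longrightarrow> even (card {x\<in>Z. D i w x = a})"
    and K0_pair: "x \<in> X \<Longrightarrow> y \<in> X \<Longrightarrow> x \<noteq> y \<Longrightarrow> {x, y} \<notin> K0"
    and K0_unique: "Z \<subseteq> X \<Longrightarrow> x \<in> X - Z \<Longrightarrow> y \<in> X - Z \<Longrightarrow> insert x Z \<in> K0 \<Longrightarrow> insert y Z \<in> K0 \<Longrightarrow> x = y"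
    and level: "\<And>i E P. i \<le> d \<Longrightarrow> matching E \<Longrightarrow> \<Union>E \<subseteq> X \<Longrightarrow>
      (\<And>w w'. same i w w' \<Longrightarrow> P w = P w') \<Longrightarrow> (\<And>w. w \<in> \<Omega> \<Longrightarrow> P w \<Longrightarrow> indep (Ker i w) E) \<Longrightarrow>
      dens \<Omega> (\<lambda>w. P w \<and> matched (D i w) E) * N ^ card E \<le> dens \<Omega> P"
begin

lemma Ker_le_0: "w \<in> \<Omega> \<Longrightarrow> Z \<subseteq> X \<Longrightarrow> Z \<in> Ker i w \<Longrightarrow> Z \<in> K0"
  by (induction i) (auto simp: Ker_0 intro: Ker_Suc)

lemma pairing_exists:
  assumes "w \<in> \<Omega>" "Z \<subseteq> X" "Z \<in> Ker (Suc i) w"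
  shows "\<exists>f. pairing f Z \<and> (\<forall>x\<in>Z. D i w (f x) = D i w x)"
  using assms finite_X by (intro pairing_of_even_fibres even_fibres) (auto intro: finite_subset)

text \<open>At the first dependency of a greedy exploration, \<open>level\<close> charges
  \<open>1 / N\<close> for each of the \<open>j\<close> independent pairs, and the induction
  hypothesis bounds the dependent set formed by \<open>E'\<close> and the last pair, one level down.
  Summing the weights over \<open>E'\<close>, \<open>E\<close> and \<open>j\<close> gains the factor
  \<open>3 / N\<close>.\<close>

lemma dens_Ker_le:
  assumes "Z \<subseteq> X" "card Z = 2 * m" "2 \<le> m" "i \<le> Suc d"
  shows "dens \<Omega> (\<lambda>w. Z \<in> Ker i w) \<le> 2 ^ (m - 2) * (3 / N) ^ i"
  using assms
proof (induction i arbitrary: Z m)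
  case 0
  have "dens \<Omega> (\<lambda>w. Z \<in> Ker 0 w) \<le> 1" by (rule dens_le_1[OF finite_Omega])
  also have "\<dots> \<le> 2 ^ (m - 2)" by simp
  finally show ?case by simp
next
  case (Suc i)
  have N: "N > 0" using N_ge by simp
  have finZ: "finite Z" using Suc.prems finite_X by (auto intro: finite_subset)
  define p where "p E = pick (Z - \<Union>E)" for E
  define Y where "Y E E' = {y \<in> Z - \<Union>E - {p E}. insert y (insert (p E) (\<Union>E')) \<in> K0}" for E E'
  \<comment> \<open>The bracketing separates the condition on the tables below level
    \<open>i\<close> from the matching at level \<open>i\<close>, as \<open>level\<close>
    requires.\<close>
  define W where "W E E' y w \<longleftrightarrow> (insert y (insert (p E) (\<Union>E')) \<in> Ker i w \<and> indep (Ker i w) E)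
    \<and> matched (D i w) E" for E E' y w
  have "dens \<Omega> (\<lambda>w. Z \<in> Ker (Suc i) w) \<le>
     dens \<Omega> (\<lambda>w. \<exists>j\<in>{1..<m}. \<exists>E\<in>greedy Z j. \<exists>E'\<in>Pow E - {{}}. \<exists>y\<in>Y E E'. W E E' y w)"
  proof (rule dens_mono[OF finite_Omega])
    fix w assume w: "w \<in> \<Omega>" and Z: "Z \<in> Ker (Suc i) w"
    obtain f where f: "pairing f Z" "\<forall>x\<in>Z. D i w (f x) = D i w x"
      using pairing_exists[OF w Suc.prems(1) Z] by auto
    have ZK: "Z \<in> Ker i w" by (rule Ker_Suc[OF w Suc.prems(1) Z])
    have "{x, y} \<notin> Ker i w" if "x \<in> Z" "y \<in> Z" "x \<noteq> y" for x y
      using that K0_pair[of x y] Ker_le_0[OF w, of "{x, y}" i] Suc.prems(1) by auto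
    moreover have "Z \<noteq> {}" using Suc.prems by auto
    ultimately obtain j E E' y where j: "0 < j" "j < card Z div 2" and E: "E \<in> greedy Z j"
      "E \<subseteq> edges f Z" "indep (Ker i w) E" and E': "E' \<subseteq> E" "E' \<noteq> {}"
      and y: "y \<in> Z - \<Union>E - {p E}" "{p E, y} \<union> \<Union>E' \<in> Ker i w"
      using greedy_first_dependency[OF finZ f(1) ZK] unfolding p_def by blast
    have "{p E, y} \<union> \<Union>E' \<subseteq> X"
    proof -
      have "p E \<in> Z" using y pick_in[of "Z - \<Union>E"] unfolding p_def by auto
      moreover have "\<Union>E' \<subseteq> Z" using greedy_props[OF finZ E(1)] E'(1) by auto
      ultimately show ?thesis using y Suc.prems(1) by auto
    qed
    then have "{p E, y} \<union> \<Union>E' \<in> K0" using y Ker_le_0[OF w] by auto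
    moreover have eq: "{p E, y} \<union> \<Union>E' = insert y (insert (p E) (\<Union>E'))" by auto
    ultimately have "y \<in> Y E E'" using y unfolding Y_def by auto
    moreover have "W E E' y w" unfolding W_def using y(2) E(3) matched_edges[OF f E(2)] eq by auto
    ultimately show "\<exists>j\<in>{1..<m}. \<exists>E\<in>greedy Z j. \<exists>E'\<in>Pow E - {{}}. \<exists>y\<in>Y E E'. W E E' y w"
      using j E E' Suc.prems(2) by (intro bexI[of _ j] bexI[of _ E] bexI[of _ E'] bexI[of _ y]) auto
  qed
  also have "\<dots> \<le> (\<Sum>j=1..<m. dens \<Omega> (\<lambda>w. \<exists>E\<in>greedy Z j. \<exists>E'\<in>Pow E - {{}}. \<exists>y\<in>Y E E'. W E E' y w))"
    by (rule dens_Bex_le[OF finite_Omega]) simp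
  also have "\<dots> \<le> (\<Sum>j=1..<m. real (\<Prod>l<j. 2 * m - 1 - 2 * l) * ((3 ^ j - 1) / 2 * ((3 / N) ^ i / N ^ j)))"
  proof (rule sum_mono, rule dens_Bex_le_mult[OF finite_Omega finite_greedy[OF finZ]])
    fix j assume j: "j \<in> {1..<m}"
    show "real (card (greedy Z j)) \<le> real (\<Prod>l<j. 2 * m - 1 - 2 * l)"
      using card_greedy_le[OF finZ, of j] Suc.prems(2) of_nat_mono by metis
    show "0 \<le> (3 ^ j - 1) / 2 * ((3 / N) ^ i / N ^ j)" using N by simp
    fix E assume E: "E \<in> greedy Z j"
    note Ep = greedy_props[OF finZ E]
    then have finE: "finite E" by (simp add: matching_def)
    have "dens \<Omega> (\<lambda>w. \<exists>E'\<in>Pow E - {{}}. \<exists>y\<in>Y E E'. W E E' y w)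
      \<le> (\<Sum>E'\<in>Pow E - {{}}. dens \<Omega> (\<lambda>w. \<exists>y\<in>Y E E'. W E E' y w))"
      using finE by (intro dens_Bex_le[OF finite_Omega]) simp
    also have "\<dots> \<le> (\<Sum>E'\<in>Pow E - {{}}. 2 ^ (card E' - 1) * ((3 / N) ^ i / N ^ j))"
    proof (rule sum_mono)
      fix E' assume E': "E' \<in> Pow E - {{}}"
      have finY: "finite (Y E E')" using finZ unfolding Y_def by auto
      have mE': "matching E'" using Ep E' matching_subset by auto
      have c0: "card E' > 0" using E' finE by (auto simp: card_gt_0_iff intro: finite_subset)
      have UE': "\<Union>E' \<subseteq> \<Union>E" using E' by auto
      have pE: "p E \<in> Z - \<Union>E" if "y \<in> Y E E'" for y
        using that pick_in[of "Z - \<Union>E"] unfolding p_def Y_def by auto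
      have "dens \<Omega> (\<lambda>w. \<exists>y\<in>Y E E'. W E E' y w) \<le> 1 * (2 ^ (card E' - 1) * ((3 / N) ^ i / N ^ j))"
      proof (rule dens_Bex_le_mult[OF finite_Omega finY])
        show "0 \<le> 2 ^ (card E' - 1) * ((3 / N) ^ i / N ^ j)" using N by simp
        \<comment> \<open>The last key is determined by \<open>p E\<close> and \<open>E'\<close>, so
          the union over \<open>y\<close> has at most one term.\<close>
        have "card (Y E E') \<le> 1"
        proof (rule card_le_Suc0_iff_eq[OF finY, THEN iffD2, folded One_nat_def], intro ballI)
          fix y y' assume y: "y \<in> Y E E'" "y' \<in> Y E E'"
          have "\<Union>E' \<subseteq> X" using UE' Ep Suc.prems(1) by (meson subset_trans)
          then have "insert (p E) (\<Union>E') \<subseteq> X" using pE[OF y(1)] Suc.prems(1) by auto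
          moreover have "y \<notin> \<Union>E'" "y' \<notin> \<Union>E'" using y UE' unfolding Y_def by blast+
          ultimately show "y = y'"
            using K0_unique[of "insert (p E) (\<Union>E')" y y'] y Suc.prems(1) unfolding Y_def by auto
        qed
        then show "real (card (Y E E')) \<le> 1" by simp
        fix y assume y: "y \<in> Y E E'"
        define T where "T = insert y (insert (p E) (\<Union>E'))"
        \<comment> \<open>These are at least four keys, as \<open>E'\<close> is nonempty, so the
          induction hypothesis applies with \<open>card E' + 1\<close> for \<open>m\<close>.\<close>
        have "card T = 2 * (card E' + 1)"
          unfolding T_def using y pE[OF y] UE' finite_Union_matching[OF mE'] card_Union_matching[OF mE']
          unfolding Y_def by (subst card_insert_disjoint) (auto simp: card_insert_if)
        moreover have "\<Union>E' \<subseteq> X" using UE' Ep Suc.prems(1) by (meson subset_trans)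
        then have "T \<subseteq> X" unfolding T_def using y pE[OF y] Suc.prems(1) unfolding Y_def by auto
        ultimately have "dens \<Omega> (\<lambda>w. T \<in> Ker i w) \<le> 2 ^ (card E' + 1 - 2) * (3 / N) ^ i"
          using c0 Suc.prems by (intro Suc.IH) auto
        moreover have "dens \<Omega> (\<lambda>w. T \<in> Ker i w \<and> indep (Ker i w) E) \<le> dens \<Omega> (\<lambda>w. T \<in> Ker i w)"
          by (rule dens_mono[OF finite_Omega]) auto
        moreover have "dens \<Omega> (W E E' y) * N ^ card E \<le> dens \<Omega> (\<lambda>w. T \<in> Ker i w \<and> indep (Ker i w) E)"
          unfolding W_def T_def
        proof (rule level)
          fix w w' assume "same i w w'"
          then have "Ker i w = Ker i w'" by (rule Ker_same)
          then show "(insert y (insert (p E) (\<Union>E')) \<in> Ker i w \<and> indep (Ker i w) E) =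
            (insert y (insert (p E) (\<Union>E')) \<in> Ker i w' \<and> indep (Ker i w') E)" by simp
        qed (use Ep Suc.prems in auto)
        ultimately have "dens \<Omega> (W E E' y) * N ^ j \<le> 2 ^ (card E' - 1) * (3 / N) ^ i"
          using Ep by simp
        then show "dens \<Omega> (W E E' y) \<le> 2 ^ (card E' - 1) * ((3 / N) ^ i / N ^ j)"
          using N by (simp add: pos_le_divide_eq)
      qed
      then show "dens \<Omega> (\<lambda>w. \<exists>y\<in>Y E E'. W E E' y w) \<le> 2 ^ (card E' - 1) * ((3 / N) ^ i / N ^ j)" by simp
    qed
    also have "\<dots> = (3 ^ j - 1) / 2 * ((3 / N) ^ i / N ^ j)"
      unfolding sum_distrib_right[symmetric] sum_pow_nonempty_subsets[OF finE] using Ep by simp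
    finally show "dens \<Omega> (\<lambda>w. \<exists>E'\<in>Pow E - {{}}. \<exists>y\<in>Y E E'. W E E' y w)
      \<le> (3 ^ j - 1) / 2 * ((3 / N) ^ i / N ^ j)" .
  qed
  also have "\<dots> = (\<Sum>j=1..<m. real (\<Prod>l<j. 2 * m - 1 - 2 * l) * ((3 ^ j - 1) / 2) / N ^ j) * (3 / N) ^ i"
    unfolding sum_distrib_right by (rule sum.cong) (auto simp: mult_ac)
  also have "\<dots> \<le> 2 ^ (m - 2) * (3 / N) * (3 / N) ^ i"
  proof (intro mult_right_mono greedy_weight_le)
    have "2 * m \<le> card X" using Suc.prems card_mono[OF finite_X Suc.prems(1)] by simp
    then show "4 * real m \<le> N" using card_X by linarith
  qed (use N N_ge Suc.prems in auto)
  finally show ?case by simp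
qed

end

section \<open>Numerical estimates for the top two levels\<close>

lemma prod_odd_reverse: "(\<Prod>l<u. 2 * u - 1 - 2 * l) = (\<Prod>l<u. 2 * l + 1 :: nat)"
proof -
  have "(\<Prod>l<u. 2 * u - 1 - 2 * l) = (\<Prod>l<u. 2 * (u - Suc l) + 1)"
    by (rule prod.cong) auto
  also have "\<dots> = (\<Prod>l<u. 2 * l + 1)" by (rule prod.nat_diff_reindex)
  finally show ?thesis .
qed

text \<open>The left side is \<open>(2 * u + 1)!!\<close> squared. Its quotient by
  \<open>fact (2 * u + 1)\<close> is \<open>(2 * u + 1)!! / (2 * u)!!\<close>, which grows like a
  square root, so a linear bound is enough.\<close>

lemma prod_odd_square_le:
  "(real (\<Prod>l<Suc u. 2 * l + 1))\<^sup>2 \<le> fact (2 * u + 1) * ((real u + 2) / 2)"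
proof (induction u)
  case 0
  show ?case by simp
next
  case (Suc u)
  have "(real (\<Prod>l<Suc (Suc u). 2 * l + 1))\<^sup>2 = (2 * real u + 3)\<^sup>2 * (real (\<Prod>l<Suc u. 2 * l + 1))\<^sup>2"
  proof -
    have "real (2 * Suc u + 1) = 2 * real u + 3" by simp
    then show ?thesis
      unfolding prod.lessThan_Suc[of _ "Suc u"] of_nat_mult power_mult_distrib by (simp only: mult.commute)
  qed
  also have "\<dots> \<le> (2 * real u + 3)\<^sup>2 * (fact (2 * u + 1) * ((real u + 2) / 2))"
    using Suc.IH by (intro mult_left_mono) auto
  also have "\<dots> = (2 * real u + 3) * fact (2 * u + 1) * ((2 * real u + 3) * (real u + 2) / 2)"
    by (simp add: power2_eq_square)
  also have "\<dots> \<le> (2 * real u + 3) * fact (2 * u + 1) * ((2 * real u + 2) * (real u + 3) / 2)"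
    by (intro mult_left_mono) (auto simp: algebra_simps)
  also have "\<dots> = fact (2 * Suc u + 1) * ((real (Suc u) + 2) / 2)"
  proof -
    have "2 * Suc u + 1 = Suc (Suc (2 * u + 1))" by simp
    then have "(fact (2 * Suc u + 1) :: real) = (2 * real u + 3) * ((2 * real u + 2) * fact (2 * u + 1))"
      by (simp only: fact_Suc) (simp add: add.commute)
    moreover have "real (Suc u) + 2 = real u + 3" by simp
    ultimately show ?thesis by (simp only: times_divide_eq_right mult_ac)
  qed
  finally show ?case .
qed

text \<open>The value 18 is the full series: 12 from \<open>u * (3/4) ^ u\<close> and 6 from
  \<open>2 * (3/4) ^ u\<close>.\<close>

lemma sum_linear_geometric: "(\<Sum>u=1..n. (real u + 2) * (3/4) ^ u) \<le> 18"
proof -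
  have "(\<Sum>u=1..n. (real u + 2) * (3/4) ^ u) = 18 - (3 * real n + 18) * (3/4) ^ n"
    by (induction n) (simp_all add: field_simps)
  also have "\<dots> \<le> 18" by simp
  finally show ?thesis .
qed

text \<open>The factors count the choices of \<open>U\<close>, of its two ends, of the two matchings
  (\<open>q\<close> each) and, weighted, of the subfamily \<open>E'\<close>. Since
  \<open>(2 * u + 1) * q\<close> is an odd double factorial, its square cancels the factorial in the
  binomial coefficient up to a linear factor. Then \<open>n / N \<le> 1/2\<close> gives a quarter
  per step of \<open>u\<close>, which \<open>3 ^ u\<close> turns into 3/4.\<close>

lemma obstruction_weight_le:
  fixes N c :: real
  assumes "1 \<le> u" "0 < N" "2 * real n \<le> N" "0 \<le> c"
  defines "q \<equiv> real (\<Prod>l<u. 2 * u - 1 - 2 * l)"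
  shows "real (n choose (2 * u + 1)) * (real (2 * u + 1) * (real (2 * u + 1) * (q * (q *
     ((3 ^ u - 1) / 2 * (c / N ^ (2 * u))))))) \<le> real n ^ 3 / N\<^sup>2 * c * ((real u + 2) * (3/4) ^ u)"
proof -
  define Q where "Q = real (\<Prod>l<Suc u. 2 * l + 1)"
  have Q: "Q = real (2 * u + 1) * q" unfolding Q_def q_def prod_odd_reverse by (simp add: algebra_simps)
  have "real (n choose (2 * u + 1)) * Q\<^sup>2 \<le> real (n choose (2 * u + 1)) * (fact (2 * u + 1) * ((real u + 2) / 2))"
    unfolding Q_def by (intro mult_left_mono prod_odd_square_le) auto
  also have "\<dots> = real ((n choose (2 * u + 1)) * fact (2 * u + 1)) * ((real u + 2) / 2)"
    by (simp only: of_nat_mult of_nat_fact mult.assoc)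
  also have "\<dots> \<le> real (n ^ (2 * u + 1)) * ((real u + 2) / 2)"
    by (intro mult_right_mono of_nat_mono binomial_fact_pow) auto
  finally have a: "real (n choose (2 * u + 1)) * Q\<^sup>2 \<le> real n ^ (2 * u + 1) * ((real u + 2) / 2)" by simp
  have pw: "2 * u + 1 = 3 + 2 * (u - 1)" "2 * u = 2 + 2 * (u - 1)" using assms(1) by auto
  have "real n ^ (2 * u + 1) / N ^ (2 * u) = real n ^ 3 / N\<^sup>2 * ((real n / N)\<^sup>2) ^ (u - 1)"
    unfolding pw power_add power_mult power_divide
    by (simp add: power2_eq_square power3_eq_cube)
  also have "\<dots> \<le> real n ^ 3 / N\<^sup>2 * ((1/2)\<^sup>2) ^ (u - 1)"
    using assms by (intro mult_left_mono power_mono) (auto simp: field_simps)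
  finally have b: "real n ^ (2 * u + 1) / N ^ (2 * u) \<le> real n ^ 3 / N\<^sup>2 * (1/4) ^ (u - 1)"
    by (simp add: power_divide)
  have "real (n choose (2 * u + 1)) * (real (2 * u + 1) * (real (2 * u + 1) * (q * (q *
     ((3 ^ u - 1) / 2 * (c / N ^ (2 * u)))))))
     = (real (n choose (2 * u + 1)) * Q\<^sup>2) * (((3 ^ u - 1) / 2) * (c / N ^ (2 * u)))"
    unfolding Q power2_eq_square by (simp only: mult_ac)
  also have "\<dots> \<le> (real n ^ (2 * u + 1) * ((real u + 2) / 2)) * (((3 ^ u - 1) / 2) * (c / N ^ (2 * u)))"
    using a assms by (intro mult_right_mono) auto
  also have "\<dots> \<le> (real n ^ (2 * u + 1) * ((real u + 2) / 2)) * ((3 ^ u / 2) * (c / N ^ (2 * u)))"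
    using assms by (intro mult_left_mono mult_right_mono) auto
  also have "\<dots> = (real n ^ (2 * u + 1) / N ^ (2 * u)) * (c * ((real u + 2) * 3 ^ u / 4))"
    by (simp add: mult_ac)
  also have "\<dots> \<le> (real n ^ 3 / N\<^sup>2 * (1/4) ^ (u - 1)) * (c * ((real u + 2) * 3 ^ u / 4))"
    using b assms by (intro mult_right_mono) auto
  also have "\<dots> = real n ^ 3 / N\<^sup>2 * c * ((real u + 2) * (3/4) ^ u)"
    using assms(1) by (cases u) (auto simp: power_divide)
  finally show ?thesis .
qed

section \<open>Union bound over the top two levels\<close>

context kernel_levels
begin

text \<open>A last key \<^term>\<open>v\<close> completing a dependent set is determined by the other ones
  (\<open>K0_unique\<close>), so it costs no factor \<^term>\<open>card X\<close>.\<close>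
definition completions :: "'x set \<Rightarrow> 'x set \<Rightarrow> 'x set" where
  "completions U A = {v \<in> X - U. insert v A \<in> K0}"

text \<open>The flag \<open>s\<close> tells which level carries \<open>E\<close>, the matching whose
  extension is dependent: level \<open>d\<close> if \<open>s\<close> holds, level
  \<open>d - 1\<close> otherwise. The nesting of the conjunctions follows the two applications of
  \<open>level\<close>.\<close>

definition obstructed :: "bool \<Rightarrow> 'x set set \<Rightarrow> 'x set set \<Rightarrow> 'x set \<Rightarrow> 'w \<Rightarrow> bool" where
  "obstructed s E F T w \<longleftrightarrow>
    (if s then ((T \<in> Ker (d - 1) w \<and> indep (Ker (d - 1) w) E \<and> indep (Ker (d - 1) w) F)
      \<and> matched (D (d - 1) w) F) \<and> matched (D d w) E
     else ((T \<in> Ker (d - 1) w \<and> indep (Ker (d - 1) w) F \<and> indep (Ker (d - 1) w) E)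
      \<and> matched (D (d - 1) w) E) \<and> matched (D d w) F)"

text \<open>\<open>level\<close> is applied at level \<open>d\<close> and then at level
  \<open>d - 1\<close>. Independence is assumed only for \<open>Ker (d - 1)\<close>, but it passes
  to level \<open>d\<close> because a set dependent at \<open>d\<close> is dependent at
  \<open>d - 1\<close>.\<close>

lemma dens_two_levels:
  assumes "matching E" "\<Union>E \<subseteq> X" "matching F" "\<Union>F \<subseteq> X"
  shows "dens \<Omega> (\<lambda>w. ((T \<in> Ker (d - 1) w \<and> indep (Ker (d - 1) w) E \<and> indep (Ker (d - 1) w) F)
      \<and> matched (D (d - 1) w) F) \<and> matched (D d w) E) * N ^ (card E + card F)
    \<le> dens \<Omega> (\<lambda>w. T \<in> Ker (d - 1) w)"
proof -
  have N: "N > 0" using N_ge by simp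
  define P where "P w \<longleftrightarrow> T \<in> Ker (d - 1) w \<and> indep (Ker (d - 1) w) E \<and> indep (Ker (d - 1) w) F" for w
  have P_same: "P w = P w'" if "same (d - 1) w w'" for w w'
    using Ker_same[OF that] unfolding P_def by simp
  have sd: "Suc (d - 1) = d" using d_ge by simp
  have "dens \<Omega> (\<lambda>w. (P w \<and> matched (D (d - 1) w) F) \<and> matched (D d w) E) * N ^ card E
      \<le> dens \<Omega> (\<lambda>w. P w \<and> matched (D (d - 1) w) F)"
  proof (rule level)
    fix w w' assume s: "same d w w'"
    then have "same (d - 1) w w'" "D (d - 1) w = D (d - 1) w'"
      using same_Suc[of "d - 1" w w'] D_same[of "d - 1" w w'] sd by auto
    then show "(P w \<and> matched (D (d - 1) w) F) = (P w' \<and> matched (D (d - 1) w') F)"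
      using P_same by simp
  next
    fix w assume w: "w \<in> \<Omega>" "P w \<and> matched (D (d - 1) w) F"
    show "indep (Ker d w) E"
      unfolding indep_def
    proof (intro allI impI notI)
      fix E' assume E': "E' \<subseteq> E" "E' \<noteq> {}" "\<Union>E' \<in> Ker d w"
      then have "\<Union>E' \<subseteq> X" using assms(2) by blast
      then have "\<Union>E' \<in> Ker (d - 1) w" using Ker_Suc[OF w(1), of _ "d - 1"] E'(3) sd by auto
      then show False using w E' unfolding P_def indep_def by blast
    qed
  qed (use assms in auto)
  moreover have "dens \<Omega> (\<lambda>w. P w \<and> matched (D (d - 1) w) F) * N ^ card F \<le> dens \<Omega> P"
    using assms P_same unfolding P_def by (intro level) auto
  moreover have "dens \<Omega> P \<le> dens \<Omega> (\<lambda>w. T \<in> Ker (d - 1) w)"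
    unfolding P_def by (intro dens_mono[OF finite_Omega]) auto
  ultimately have "dens \<Omega> (\<lambda>w. (P w \<and> matched (D (d - 1) w) F) \<and> matched (D d w) E) * N ^ card E * N ^ card F
     \<le> dens \<Omega> (\<lambda>w. T \<in> Ker (d - 1) w)"
    using N mult_right_mono[of _ _ "N ^ card F"] by (meson order_trans zero_le_power less_imp_le)
  then show ?thesis unfolding P_def by (simp add: power_add mult.assoc)
qed

text \<open>The two matchings contribute \<open>1 / N ^ (2 * u)\<close>, and the set completed from
  \<open>E'\<close> has \<open>2 * (card E' + 1)\<close> keys, to which \<open>dens_Ker_le\<close>
  applies at level \<open>d - 1\<close>. The completing key is unique, so only the choice of
  \<open>E'\<close> is summed.\<close>

lemma dens_obstruction_le:
  fixes s :: bool
  assumes "\<alpha> \<in> U" "U \<subseteq> X" and E: "matching E" "\<Union>E \<subseteq> U - {\<alpha>}" "card E = u"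
    and F: "matching F" "\<Union>F \<subseteq> U" "card F = u"
  shows "dens \<Omega> (\<lambda>w. \<exists>E'\<in>Pow E - {{}}. \<exists>v\<in>completions U (insert \<alpha> (\<Union>E')).
      obstructed s E F (insert v (insert \<alpha> (\<Union>E'))) w)
    \<le> (3 ^ u - 1) / 2 * ((3 / N) ^ (d - 1) / N ^ (2 * u))"
proof -
  have N: "N > 0" using N_ge by simp
  have finE: "finite E" using E by (simp add: matching_def)
  have "dens \<Omega> (\<lambda>w. \<exists>E'\<in>Pow E - {{}}. \<exists>v\<in>completions U (insert \<alpha> (\<Union>E')).
      obstructed s E F (insert v (insert \<alpha> (\<Union>E'))) w)
    \<le> (\<Sum>E'\<in>Pow E - {{}}. dens \<Omega> (\<lambda>w. \<exists>v\<in>completions U (insert \<alpha> (\<Union>E')).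
      obstructed s E F (insert v (insert \<alpha> (\<Union>E'))) w))"
    using finE by (intro dens_Bex_le[OF finite_Omega]) simp
  also have "\<dots> \<le> (\<Sum>E'\<in>Pow E - {{}}. 1 * (2 ^ (card E' - 1) * ((3 / N) ^ (d - 1) / N ^ (2 * u))))"
  proof (rule sum_mono)
    fix E' assume E': "E' \<in> Pow E - {{}}"
    have mE': "matching E'" using E E' matching_subset by auto
    have c0: "card E' > 0" using E' finE by (auto simp: card_gt_0_iff intro: finite_subset)
    have UE': "\<Union>E' \<subseteq> U - {\<alpha>}" using E' E(2) by blast
    let ?Y = "completions U (insert \<alpha> (\<Union>E'))"
    have finY: "finite ?Y" using finite_X unfolding completions_def by auto
    show "dens \<Omega> (\<lambda>w. \<exists>v\<in>?Y. obstructed s E F (insert v (insert \<alpha> (\<Union>E'))) w)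
      \<le> 1 * (2 ^ (card E' - 1) * ((3 / N) ^ (d - 1) / N ^ (2 * u)))"
    proof (rule dens_Bex_le_mult[OF finite_Omega finY])
      show "0 \<le> 2 ^ (card E' - 1) * ((3 / N) ^ (d - 1) / N ^ (2 * u))" using N by simp
      have "card ?Y \<le> 1"
      proof (rule card_le_Suc0_iff_eq[OF finY, THEN iffD2, folded One_nat_def], intro ballI)
        fix y y' assume y: "y \<in> ?Y" "y' \<in> ?Y"
        have "insert \<alpha> (\<Union>E') \<subseteq> U" using UE' assms(1) by blast
        then show "y = y'"
          using K0_unique[of "insert \<alpha> (\<Union>E')" y y'] y assms(2) unfolding completions_def by blast
      qed
      then show "real (card ?Y) \<le> 1" by simp
      fix v assume v: "v \<in> ?Y"
      define T where "T = insert v (insert \<alpha> (\<Union>E'))"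
      have vU: "v \<in> X" "v \<notin> U" using v unfolding completions_def by auto
      have nin: "\<alpha> \<notin> \<Union>E'" "v \<notin> insert \<alpha> (\<Union>E')" using UE' vU assms(1) by blast+
      have "card T = 2 * (card E' + 1)"
        unfolding T_def using nin finite_Union_matching[OF mE'] card_Union_matching[OF mE'] by simp
      moreover have "T \<subseteq> X" unfolding T_def using vU UE' assms(1,2) by blast
      ultimately have T: "dens \<Omega> (\<lambda>w. T \<in> Ker (d - 1) w) \<le> 2 ^ (card E' + 1 - 2) * (3 / N) ^ (d - 1)"
        using c0 by (intro dens_Ker_le) auto
      have EX: "\<Union>E \<subseteq> X" "\<Union>F \<subseteq> X" using E(2) F(2) assms(2) by auto
      have "dens \<Omega> (obstructed s E F T) * N ^ (card E + card F) \<le> dens \<Omega> (\<lambda>w. T \<in> Ker (d - 1) w)"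
      proof (cases s)
        case True
        then show ?thesis
          using dens_two_levels[OF E(1) EX(1) F(1) EX(2), of T] unfolding obstructed_def by simp
      next
        case False
        then show ?thesis
          using dens_two_levels[OF F(1) EX(2) E(1) EX(1), of T]
          unfolding obstructed_def by (simp add: add.commute)
      qed
      then have "dens \<Omega> (obstructed s E F T) * N ^ (2 * u) \<le> 2 ^ (card E' - 1) * (3 / N) ^ (d - 1)"
        using T E(3) F(3) by (simp add: mult_2)
      then show "dens \<Omega> (obstructed s E F (insert v (insert \<alpha> (\<Union>E'))))
          \<le> 2 ^ (card E' - 1) * ((3 / N) ^ (d - 1) / N ^ (2 * u))"
        unfolding T_def using N by (simp add: pos_le_divide_eq)
    qed
  qed
  also have "\<dots> = (3 ^ u - 1) / 2 * ((3 / N) ^ (d - 1) / N ^ (2 * u))"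
    unfolding mult_1 sum_distrib_right[symmetric] sum_pow_nonempty_subsets[OF finE] using E by simp
  finally show ?thesis .
qed

text \<open>A dependent \<open>Z\<close> is paired by the characters of both levels
  \<open>d - 1\<close> and \<open>d\<close>. From these pairings \<open>obstruction_exists\<close>
  extracts the data over which the union bound runs.\<close>

theorem dens_Ker_nontrivial_le:
  "dens \<Omega> (\<lambda>w. \<exists>Z\<subseteq>X. Z \<noteq> {} \<and> Z \<in> Ker (Suc d) w) \<le> 7 * real (card X) ^ 3 * (3 / N) ^ (d + 1)"
proof -
  define n where "n = card X"
  have N: "N > 0" using N_ge by simp
  have sd: "Suc (d - 1) = d" using d_ge by simp
  define C where "C u = {U. U \<subseteq> X \<and> card U = 2 * u + 1}" for u
  define q where "q u = real (\<Prod>l<u. 2 * u - 1 - 2 * l)" for u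
  define B where "B u = (3 ^ u - 1) / 2 * ((3 / N) ^ (d - 1) / N ^ (2 * u))" for u
  have B0: "0 \<le> B u" for u unfolding B_def using N by simp
  have q0: "0 \<le> q u" for u unfolding q_def by (rule of_nat_0_le_iff)
  have finU: "finite U" "U \<subseteq> X" "card U = 2 * u + 1" if "U \<in> C u" for U u
    using that finite_X unfolding C_def by (auto intro: finite_subset)
  have "dens \<Omega> (\<lambda>w. \<exists>Z\<subseteq>X. Z \<noteq> {} \<and> Z \<in> Ker (Suc d) w) \<le>
    dens \<Omega> (\<lambda>w. \<exists>s\<in>{True, False}. \<exists>u\<in>{1..n}. \<exists>U\<in>C u. \<exists>\<alpha>\<in>U. \<exists>\<gamma>\<in>U.
      \<exists>E\<in>greedy (U - {\<alpha>}) u. \<exists>F\<in>greedy (U - {\<gamma>}) u. \<exists>E'\<in>Pow E - {{}}. \<exists>v\<in>completions U (insert \<alpha> (\<Union>E')).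
        obstructed s E F (insert v (insert \<alpha> (\<Union>E'))) w)"
  proof (rule dens_mono[OF finite_Omega])
    fix w assume w: "w \<in> \<Omega>" and "\<exists>Z\<subseteq>X. Z \<noteq> {} \<and> Z \<in> Ker (Suc d) w"
    then obtain Z where Z: "Z \<subseteq> X" "Z \<noteq> {}" "Z \<in> Ker (Suc d) w" by auto
    have finZ: "finite Z" using Z finite_X by (auto intro: finite_subset)
    have Zd: "Z \<in> Ker (Suc (d - 1)) w" unfolding sd by (rule Ker_Suc[OF w Z(1,3)])
    obtain f where f: "pairing f Z" "\<forall>x\<in>Z. D d w (f x) = D d w x"
      using pairing_exists[OF w Z(1,3)] by auto
    obtain g where g: "pairing g Z" "\<forall>x\<in>Z. D (d - 1) w (g x) = D (d - 1) w x"
      using pairing_exists[OF w Z(1) Zd] by auto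
    have ZK: "Z \<in> Ker (d - 1) w" by (rule Ker_Suc[OF w Z(1) Zd])
    have "{x, y} \<notin> Ker (d - 1) w" if "x \<in> Z" "y \<in> Z" "x \<noteq> y" for x y
      using that K0_pair[of x y] Ker_le_0[OF w, of "{x, y}" "d - 1"] Z(1) by auto
    then have "\<forall>x\<in>Z. \<forall>y\<in>Z. x \<noteq> y \<longrightarrow> {x, y} \<notin> Ker (d - 1) w" by blast
    from obstruction_exists[OF finZ f(1) g(1) ZK Z(2) this]
    obtain h h' U \<alpha> \<gamma> E' v where hh: "h = f \<and> h' = g \<or> h = g \<and> h' = f"
      and U: "U \<subseteq> Z" "\<alpha> \<in> U" "\<gamma> \<in> U" and p: "pairing h (U - {\<alpha>})" "pairing h' (U - {\<gamma>})"
      and ind: "indep (Ker (d - 1) w) (edges h (U - {\<alpha>}))" "indep (Ker (d - 1) w) (edges h' (U - {\<gamma>}))"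
      and E': "E' \<subseteq> edges h (U - {\<alpha>})" "E' \<noteq> {}"
      and v: "v \<in> Z - U" "insert v (insert \<alpha> (\<Union>E')) \<in> Ker (d - 1) w"
      by metis
    have fU: "finite U" using U finZ by (auto intro: finite_subset)
    define u where "u = card (U - {\<alpha>}) div 2"
    have cU: "card (U - {\<alpha>}) = 2 * u" "card (U - {\<gamma>}) = 2 * u"
      using card_pairing[OF _ p(1)] fU U unfolding u_def by (auto simp: card_Diff_singleton)
    have "u \<noteq> 0"
    proof
      assume "u = 0"
      then have "U - {\<alpha>} = {}" using cU fU by simp
      then show False using E' unfolding edges_def by auto
    qed
    have cU': "card U = 2 * u + 1" using cU(1) card_Suc_Diff1[OF fU U(2)] by simp
    have "U \<subseteq> X" using U(1) Z(1) by (rule subset_trans)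
    then have "u \<le> n" using card_mono[OF finite_X, of U] cU' unfolding n_def by simp
    have UC: "U \<in> C u" unfolding C_def using U Z cU' by auto
    have EF: "edges h (U - {\<alpha>}) \<in> greedy (U - {\<alpha>}) u" "edges h' (U - {\<gamma>}) \<in> greedy (U - {\<gamma>}) u"
      using edges_in_greedy[OF _ p(1)] edges_in_greedy[OF _ p(2)] fU cU by auto
    have "\<Union>E' \<subseteq> U" using E'(1) Union_edges[OF p(1)] by blast
    then have "insert v (insert \<alpha> (\<Union>E')) \<subseteq> X" using v U Z by auto
    then have vV: "v \<in> completions U (insert \<alpha> (\<Union>E'))" using v Z Ker_le_0[OF w] unfolding completions_def by auto
    have sub: "edges h' (U - {x}) \<subseteq> edges h' Z" for h' x using U unfolding edges_def by auto
    have "\<exists>s. obstructed s (edges h (U - {\<alpha>})) (edges h' (U - {\<gamma>})) (insert v (insert \<alpha> (\<Union>E'))) w"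
      using hh
    proof
      assume "h = f \<and> h' = g"
      then have "obstructed True (edges h (U - {\<alpha>})) (edges h' (U - {\<gamma>})) (insert v (insert \<alpha> (\<Union>E'))) w"
        unfolding obstructed_def using v(2) ind matched_edges[OF f sub] matched_edges[OF g sub] by auto
      then show ?thesis by blast
    next
      assume "h = g \<and> h' = f"
      then have "obstructed False (edges h (U - {\<alpha>})) (edges h' (U - {\<gamma>})) (insert v (insert \<alpha> (\<Union>E'))) w"
        unfolding obstructed_def using v(2) ind matched_edges[OF f sub] matched_edges[OF g sub] by auto
      then show ?thesis by blast
    qed
    then obtain s where s: "obstructed s (edges h (U - {\<alpha>})) (edges h' (U - {\<gamma>})) (insert v (insert \<alpha> (\<Union>E'))) w" ..
    show "\<exists>s\<in>{True, False}. \<exists>u\<in>{1..n}. \<exists>U\<in>C u. \<exists>\<alpha>\<in>U. \<exists>\<gamma>\<in>U.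
      \<exists>E\<in>greedy (U - {\<alpha>}) u. \<exists>F\<in>greedy (U - {\<gamma>}) u. \<exists>E'\<in>Pow E - {{}}. \<exists>v\<in>completions U (insert \<alpha> (\<Union>E')).
        obstructed s E F (insert v (insert \<alpha> (\<Union>E'))) w"
      by (rule bexI[of _ s], rule bexI[of _ u], rule bexI[OF _ UC], rule bexI[OF _ U(2)],
          rule bexI[OF _ U(3)], rule bexI[OF _ EF(1)], rule bexI[OF _ EF(2)],
          rule bexI[of _ E'], rule bexI[OF _ vV], rule s)
        (use \<open>u \<noteq> 0\<close> \<open>u \<le> n\<close> E' in simp_all)
  qed
  \<comment> \<open>The factor 2 accounts for the flag \<open>s\<close>.\<close>
  also have "\<dots> \<le> 2 * (\<Sum>u=1..n. real (n choose (2 * u + 1)) * (real (2 * u + 1) * (real (2 * u + 1) * (q u * (q u * B u)))))"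
  proof (rule dens_Bex_le_mult[OF finite_Omega], simp)
    fix s :: bool assume "s \<in> {True, False}"
    have "dens \<Omega> (\<lambda>w. \<exists>u\<in>{1..n}. \<exists>U\<in>C u. \<exists>\<alpha>\<in>U. \<exists>\<gamma>\<in>U.
      \<exists>E\<in>greedy (U - {\<alpha>}) u. \<exists>F\<in>greedy (U - {\<gamma>}) u. \<exists>E'\<in>Pow E - {{}}. \<exists>v\<in>completions U (insert \<alpha> (\<Union>E')).
        obstructed s E F (insert v (insert \<alpha> (\<Union>E'))) w) \<le> (\<Sum>u=1..n. dens \<Omega> (\<lambda>w. \<exists>U\<in>C u. \<exists>\<alpha>\<in>U. \<exists>\<gamma>\<in>U.
      \<exists>E\<in>greedy (U - {\<alpha>}) u. \<exists>F\<in>greedy (U - {\<gamma>}) u. \<exists>E'\<in>Pow E - {{}}. \<exists>v\<in>completions U (insert \<alpha> (\<Union>E')).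
        obstructed s E F (insert v (insert \<alpha> (\<Union>E'))) w))"
      by (rule dens_Bex_le[OF finite_Omega]) simp
    also have "\<dots> \<le> (\<Sum>u=1..n. real (n choose (2 * u + 1)) * (real (2 * u + 1) * (real (2 * u + 1) * (q u * (q u * B u)))))"
    proof (rule sum_mono)
      fix u assume "u \<in> {1..n}"
      note nn = q0[of u] B0[of u]
      show "dens \<Omega> (\<lambda>w. \<exists>U\<in>C u. \<exists>\<alpha>\<in>U. \<exists>\<gamma>\<in>U.
        \<exists>E\<in>greedy (U - {\<alpha>}) u. \<exists>F\<in>greedy (U - {\<gamma>}) u. \<exists>E'\<in>Pow E - {{}}. \<exists>v\<in>completions U (insert \<alpha> (\<Union>E')).
          obstructed s E F (insert v (insert \<alpha> (\<Union>E'))) w) \<le> real (n choose (2 * u + 1)) * (real (2 * u + 1) *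
          (real (2 * u + 1) * (q u * (q u * B u))))"
      proof (rule dens_Bex_le_mult[OF finite_Omega])
        show "finite (C u)" unfolding C_def using finite_X by auto
        show "real (card (C u)) \<le> real (n choose (2 * u + 1))"
          unfolding C_def n_def using n_subsets[OF finite_X, of "2 * u + 1"] by simp
        fix U assume U: "U \<in> C u"
        show "dens \<Omega> (\<lambda>w. \<exists>\<alpha>\<in>U. \<exists>\<gamma>\<in>U.
          \<exists>E\<in>greedy (U - {\<alpha>}) u. \<exists>F\<in>greedy (U - {\<gamma>}) u. \<exists>E'\<in>Pow E - {{}}. \<exists>v\<in>completions U (insert \<alpha> (\<Union>E')).
          obstructed s E F (insert v (insert \<alpha> (\<Union>E'))) w) \<le> real (2 * u + 1) *
          (real (2 * u + 1) * (q u * (q u * B u)))"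
        proof (rule dens_Bex_le_mult[OF finite_Omega finU(1)[OF U]])
          show "real (card U) \<le> real (2 * u + 1)" using finU[OF U] by simp
          fix \<alpha> assume \<alpha>: "\<alpha> \<in> U"
          show "dens \<Omega> (\<lambda>w. \<exists>\<gamma>\<in>U.
            \<exists>E\<in>greedy (U - {\<alpha>}) u. \<exists>F\<in>greedy (U - {\<gamma>}) u. \<exists>E'\<in>Pow E - {{}}. \<exists>v\<in>completions U (insert \<alpha> (\<Union>E')).
            obstructed s E F (insert v (insert \<alpha> (\<Union>E'))) w) \<le>
            real (2 * u + 1) * (q u * (q u * B u))"
          proof (rule dens_Bex_le_mult[OF finite_Omega finU(1)[OF U]])
            show "real (card U) \<le> real (2 * u + 1)" using finU[OF U] by simp
            fix \<gamma> assume \<gamma>: "\<gamma> \<in> U"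
            have cg: "finite (greedy (U - {x}) u) \<and> real (card (greedy (U - {x}) u)) \<le> q u" if "x \<in> U" for x
            proof -
              have "finite (U - {x})" "card (U - {x}) = 2 * u" using finU[OF U] that by auto
              then show ?thesis using card_greedy_le[of "U - {x}" u] finite_greedy[of "U - {x}" u]
                unfolding q_def by (metis of_nat_mono)
            qed
            show "dens \<Omega> (\<lambda>w. \<exists>E\<in>greedy (U - {\<alpha>}) u. \<exists>F\<in>greedy (U - {\<gamma>}) u. \<exists>E'\<in>Pow E - {{}}. \<exists>v\<in>completions U (insert \<alpha> (\<Union>E')).
              obstructed s E F (insert v (insert \<alpha> (\<Union>E'))) w) \<le>
              q u * (q u * B u)"
            proof (rule dens_Bex_le_mult[OF finite_Omega])
              fix E assume "E \<in> greedy (U - {\<alpha>}) u"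
              then have E: "matching E" "\<Union>E \<subseteq> U - {\<alpha>}" "card E = u"
                using greedy_props[of "U - {\<alpha>}" E u] finU[OF U] by auto
              show "dens \<Omega> (\<lambda>w. \<exists>F\<in>greedy (U - {\<gamma>}) u. \<exists>E'\<in>Pow E - {{}}. \<exists>v\<in>completions U (insert \<alpha> (\<Union>E')).
                obstructed s E F (insert v (insert \<alpha> (\<Union>E'))) w) \<le>
                q u * B u"
              proof (rule dens_Bex_le_mult[OF finite_Omega])
                fix F assume "F \<in> greedy (U - {\<gamma>}) u"
                then have F: "matching F" "\<Union>F \<subseteq> U - {\<gamma>}" "card F = u"
                  using greedy_props[of "U - {\<gamma>}" F u] finU[OF U] by auto
                show "dens \<Omega> (\<lambda>w. \<exists>E'\<in>Pow E - {{}}. \<exists>v\<in>completions U (insert \<alpha> (\<Union>E')). obstructed s E F (insert v (insert \<alpha> (\<Union>E'))) w)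
                  \<le> B u"
                  unfolding B_def using F(2) by (intro dens_obstruction_le \<alpha> finU(2)[OF U] E F(1,3)) auto
              qed (use cg[OF \<gamma>] nn in \<open>auto intro!: mult_nonneg_nonneg\<close>)
            qed (use cg[OF \<alpha>] nn in \<open>auto intro!: mult_nonneg_nonneg\<close>)
          qed (use nn in \<open>auto intro!: mult_nonneg_nonneg\<close>)
        qed (use nn in \<open>auto intro!: mult_nonneg_nonneg\<close>)
      qed (use nn in \<open>auto intro!: mult_nonneg_nonneg\<close>)
    qed
    finally show "dens \<Omega> (\<lambda>w. \<exists>u\<in>{1..n}. \<exists>U\<in>C u. \<exists>\<alpha>\<in>U. \<exists>\<gamma>\<in>U.
      \<exists>E\<in>greedy (U - {\<alpha>}) u. \<exists>F\<in>greedy (U - {\<gamma>}) u. \<exists>E'\<in>Pow E - {{}}. \<exists>v\<in>completions U (insert \<alpha> (\<Union>E')).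
        obstructed s E F (insert v (insert \<alpha> (\<Union>E'))) w) \<le> (\<Sum>u=1..n. real (n choose (2 * u + 1)) *
        (real (2 * u + 1) * (real (2 * u + 1) * (q u * (q u * B u)))))" .
  qed (use q0 B0 in \<open>auto intro!: sum_nonneg mult_nonneg_nonneg\<close>)
  also have "\<dots> \<le> 2 * (\<Sum>u=1..n. real n ^ 3 / N\<^sup>2 * (3 / N) ^ (d - 1) * ((real u + 2) * (3/4) ^ u))"
    unfolding q_def B_def using N card_X
    by (intro mult_left_mono sum_mono obstruction_weight_le) (auto simp: n_def)
  also have "\<dots> = 2 * (real n ^ 3 / N\<^sup>2 * (3 / N) ^ (d - 1)) * (\<Sum>u=1..n. (real u + 2) * (3/4) ^ u)"
    by (simp only: sum_distrib_left mult.assoc)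
  also have "\<dots> \<le> 2 * (real n ^ 3 / N\<^sup>2 * (3 / N) ^ (d - 1)) * 18"
    using N by (intro mult_left_mono sum_linear_geometric) auto
  \<comment> \<open>36 is rounded up to \<open>63 = 7 * 9\<close>; the 9 turns
    \<open>1 / N\<^sup>2\<close> into \<open>(3 / N)\<^sup>2\<close>.\<close>
  also have "\<dots> \<le> 63 * (real n ^ 3 / N\<^sup>2 * (3 / N) ^ (d - 1))"
  proof -
    have "0 \<le> real n ^ 3 / N\<^sup>2 * (3 / N) ^ (d - 1)" using N by simp
    then show ?thesis by linarith
  qed
  also have "\<dots> = 7 * real n ^ 3 * ((3 / N) ^ (d - 1) * (3 / N)\<^sup>2)"
    by (simp add: power_divide)
  also have "(3 / N) ^ (d - 1) * (3 / N)\<^sup>2 = (3 / N) ^ (d + 1)"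
    unfolding power_add[symmetric] using d_ge by simp
  finally show ?thesis unfolding n_def .
qed

end

section \<open>Systems of xor equations\<close>

notation Bit_Operations.xor (infixr "XOR" 59)

global_interpretation xorsum: comm_monoid_set "Bit_Operations.xor :: nat \<Rightarrow> nat \<Rightarrow> nat" 0
  defines xorsum = xorsum.F
  by standard

lemma xor_eq_0_iff: "a XOR b = 0 \<longleftrightarrow> a = b" for a b :: nat
  by (metis xor.assoc xor.left_neutral xor.right_neutral xor_self_eq)

lemma xor_cancel: "a XOR (a XOR b) = b" for a b :: nat
  by (simp flip: xor.assoc)

lemma xor_nat_less: "a < 2 ^ m \<Longrightarrow> b < 2 ^ m \<Longrightarrow> a XOR b < 2 ^ m" for a b :: nat
  by (simp flip: take_bit_nat_eq_self_iff)

lemma xorsum_less: "(\<And>x. x \<in> A \<Longrightarrow> f x < 2 ^ m) \<Longrightarrow> xorsum f A < 2 ^ m"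
  by (induction A rule: infinite_finite_induct) (auto intro!: xor_nat_less)

lemma xorsum_if_const:
  "finite P \<Longrightarrow> xorsum (\<lambda>l. if Q l then a else 0) P = (if odd (card {l\<in>P. Q l}) then a else 0)"
proof (induction P rule: finite_induct)
  case (insert x P)
  have "{l \<in> insert x P. Q l} = (if Q x then insert x {l\<in>P. Q l} else {l\<in>P. Q l})" by auto
  then show ?case using insert by auto
qed simp

lemma xorsum_sym_diff:
  assumes "finite A" "finite B"
  shows "xorsum f ((A - B) \<union> (B - A)) = xorsum f A XOR xorsum f B"
proof -
  have "xorsum f A = xorsum f (A \<inter> B) XOR xorsum f (A - B)"
    using assms(1) by (rule xorsum.Int_Diff)
  moreover have "xorsum f B = xorsum f (A \<inter> B) XOR xorsum f (B - A)"
    using xorsum.Int_Diff[OF assms(2), of f A] by (simp add: inf_commute)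
  moreover have "xorsum f ((A - B) \<union> (B - A)) = xorsum f (A - B) XOR xorsum f (B - A)"
    using assms by (intro xorsum.union_disjoint) auto
  ultimately show ?thesis
    by (simp add: xor.assoc xor.left_commute xor_cancel)
qed

section \<open>Counting solutions of affine systems over GF(2)\<close>

definition tables :: "'i set \<Rightarrow> nat \<Rightarrow> ('i \<Rightarrow> nat) set" where
  "tables I m = {T. \<forall>i. (i \<in> I \<longrightarrow> T i < 2 ^ m) \<and> (i \<notin> I \<longrightarrow> T i = 0)}"

lemma finite_tables: "finite I \<Longrightarrow> finite (tables I m)"
  using finite_set_of_finite_funs[of I "{..<2 ^ m}" "0::nat"] unfolding tables_def by simp

lemma card_tables:
  assumes "finite I" shows "card (tables I m) = (2 ^ m) ^ card I"
proof -
  have "bij_betw (\<lambda>T. restrict T I) (tables I m) (I \<rightarrow>\<^sub>E {..<2 ^ m})"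
    by (rule bij_betw_byWitness[where f' = "\<lambda>g i. if i \<in> I then g i else 0"])
      (auto simp: tables_def fun_eq_iff PiE_def extensional_def)
  then have "card (tables I m) = card (I \<rightarrow>\<^sub>E {..<2 ^ m :: nat})" by (rule bij_betw_same_card)
  then show ?thesis using assms by (simp add: card_PiE)
qed

text \<open>\<open>V\<close> is the coefficient vector over GF(2) and \<open>t\<close> the constant
  term. The functional is defined on all tables, not only the bounded ones.\<close>

definition affine_xor :: "'i set \<Rightarrow> (('i \<Rightarrow> nat) \<Rightarrow> nat) \<Rightarrow> bool" where
  "affine_xor I \<phi> \<longleftrightarrow> (\<exists>V t. finite V \<and> V \<subseteq> I \<and> (\<forall>S. \<phi> S = xorsum S V XOR t))"

lemma affine_xor_const: "affine_xor I (\<lambda>S. t)"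
  unfolding affine_xor_def by (intro exI[of _ "{}"] exI[of _ t]) simp

lemma affine_xor_xor:
  assumes "affine_xor I \<phi>" "affine_xor I \<psi>" shows "affine_xor I (\<lambda>S. \<phi> S XOR \<psi> S)"
proof -
  obtain V t where V: "finite V" "V \<subseteq> I" "\<And>S. \<phi> S = xorsum S V XOR t" using assms(1) unfolding affine_xor_def by blast
  obtain V' t' where V': "finite V'" "V' \<subseteq> I" "\<And>S. \<psi> S = xorsum S V' XOR t'" using assms(2) unfolding affine_xor_def by blast
  have "\<phi> S XOR \<psi> S = xorsum S ((V - V') \<union> (V' - V)) XOR (t XOR t')" for S
    unfolding xorsum_sym_diff[OF V(1) V'(1)] V V' by (simp add: xor.assoc xor.left_commute)
  then show ?thesis unfolding affine_xor_def using V V' by (intro exI[of _ "(V - V') \<union> (V' - V)"] exI[of _ "t XOR t'"]) auto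
qed

lemma affine_xor_xorsum:
  "(\<And>x. x \<in> A \<Longrightarrow> affine_xor I (\<phi> x)) \<Longrightarrow> affine_xor I (\<lambda>S. xorsum (\<lambda>x. \<phi> x S) A)"
  by (induction A rule: infinite_finite_induct) (auto intro!: affine_xor_xor affine_xor_const)

text \<open>Gaussian elimination. Independence is only required of the affine functionals, not of their
  linear parts: a dependent linear part makes the system unsolvable. This is needed at level 0,
  where the last character of the key enters as a constant.\<close>
lemma card_affine_system_le:
  assumes "finite L" "finite I" "\<And>l. l \<in> L \<Longrightarrow> affine_xor I (\<phi> l)"
    and "\<And>P. P \<subseteq> L \<Longrightarrow> P \<noteq> {} \<Longrightarrow> \<exists>S. xorsum (\<lambda>l. \<phi> l S) P \<noteq> 0"
  shows "card {T \<in> tables I m. \<forall>l\<in>L. \<phi> l T = 0} * (2 ^ m) ^ card L \<le> (2 ^ m) ^ card I"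
  using assms
proof (induction L arbitrary: I \<phi> rule: finite_induct)
  case empty
  then show ?case using card_tables[of I m] by simp
next
  case (insert l0 L)
  obtain V t where V: "finite V" "V \<subseteq> I" "\<And>S. \<phi> l0 S = xorsum S V XOR t"
    using insert.prems(2)[of l0] unfolding affine_xor_def by blast
  show ?case
  proof (cases "V = {}")
    case True
    obtain S where "xorsum (\<lambda>l. \<phi> l S) {l0} \<noteq> 0" using insert.prems(3)[of "{l0}"] by auto
    then have "t \<noteq> 0" using V(3) True by simp
    then have "{T \<in> tables I m. \<forall>l\<in>insert l0 L. \<phi> l T = 0} = {}" using V(3) True by simp
    then show ?thesis by (metis card.empty mult_0 le0)
  next
    case False
    then obtain i where i: "i \<in> V" by auto
    have "\<forall>l\<in>L. \<exists>V t. finite V \<and> V \<subseteq> I \<and> (\<forall>S. \<phi> l S = xorsum S V XOR t)"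
      using insert.prems(2) unfolding affine_xor_def by auto
    then obtain W s where W: "\<And>l. l \<in> L \<Longrightarrow> finite (W l)" "\<And>l. l \<in> L \<Longrightarrow> W l \<subseteq> I"
      "\<And>l S. l \<in> L \<Longrightarrow> \<phi> l S = xorsum S (W l) XOR s l" by metis
    \<comment> \<open>Equation \<open>l0\<close> is added to every equation that contains the pivot
      \<open>i\<close>.\<close>
    define \<psi> where "\<psi> l S = \<phi> l S XOR (if i \<in> W l then \<phi> l0 S else 0)" for l S
    have aff: "affine_xor (I - {i}) (\<psi> l)" if l: "l \<in> L" for l
    proof (cases "i \<in> W l")
      case True
      have "\<psi> l S = xorsum S ((W l - V) \<union> (V - W l)) XOR (s l XOR t)" for S
        unfolding xorsum_sym_diff[OF W(1)[OF l] V(1)] \<psi>_def using True W(3)[OF l] V(3)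
        by (simp add: xor.assoc xor.left_commute)
      moreover have "(W l - V) \<union> (V - W l) \<subseteq> I - {i}" using True i W(2)[OF l] V(2) by auto
      ultimately show ?thesis unfolding affine_xor_def using W(1)[OF l] V(1)
        by (intro exI[of _ "(W l - V) \<union> (V - W l)"] exI[of _ "s l XOR t"]) auto
    next
      case False
      then show ?thesis unfolding affine_xor_def using W(1-3)[OF l] unfolding \<psi>_def
        by (intro exI[of _ "W l"] exI[of _ "s l"]) auto
    qed
    have nz: "\<exists>S. xorsum (\<lambda>l. \<psi> l S) P \<noteq> 0" if P: "P \<subseteq> L" "P \<noteq> {}" for P
    proof -
      have finP: "finite P" using P insert.hyps by (auto intro: finite_subset)
      \<comment> \<open>Undoing the elimination: \<open>l0\<close> enters once for each equation of
        \<open>P\<close> containing the pivot, hence counts by parity.\<close>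
      define Q where "Q = (if odd (card {l\<in>P. i \<in> W l}) then insert l0 P else P)"
      have "xorsum (\<lambda>l. \<psi> l S) P = xorsum (\<lambda>l. \<phi> l S) Q" for S
      proof -
        have "l0 \<notin> P" using P insert.hyps by auto
        then show ?thesis
          unfolding \<psi>_def xorsum.distrib xorsum_if_const[OF finP] Q_def using finP
          by (simp add: xor.commute)
      qed
      moreover have "Q \<subseteq> insert l0 L" "Q \<noteq> {}" using P unfolding Q_def by auto
      ultimately show ?thesis using insert.prems(3)[of Q] by simp
    qed
    define A where "A = {T \<in> tables I m. \<forall>l\<in>insert l0 L. \<phi> l T = 0}"
    define B where "B = {T \<in> tables (I - {i}) m. \<forall>l\<in>L. \<psi> l T = 0}"
    have iI: "i \<in> I" using i V by auto
    \<comment> \<open>Erasing entry \<open>i\<close> is injective on solutions, since equation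
      \<open>l0\<close> recovers it from the other entries.\<close>
    have "card A \<le> card B"
    proof (rule card_inj_on_le)
      show "finite B" unfolding B_def using finite_tables[of "I - {i}" m] insert.prems(1) by auto
      show "(\<lambda>T. T(i := 0)) ` A \<subseteq> B"
      proof
        fix T' assume "T' \<in> (\<lambda>T. T(i := 0)) ` A"
        then obtain T where T: "T \<in> A" "T' = T(i := 0)" by auto
        have "T' \<in> tables (I - {i}) m" using T unfolding A_def tables_def by auto
        moreover have "\<psi> l T' = 0" if l: "l \<in> L" for l
        proof -
          obtain U u where U: "U \<subseteq> I - {i}" "\<And>S. \<psi> l S = xorsum S U XOR u"
            using aff[OF l] unfolding affine_xor_def by blast
          have "xorsum T' U = xorsum T U" using U(1) T(2) by (intro xorsum.cong) auto
          then have "\<psi> l T' = \<psi> l T" using U(2) by simp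
          also have "\<dots> = 0" using T(1) l unfolding A_def \<psi>_def by simp
          finally show ?thesis .
        qed
        ultimately show "T' \<in> B" unfolding B_def by auto
      qed
      show "inj_on (\<lambda>T. T(i := 0)) A"
      proof (rule inj_onI)
        fix T T' assume T: "T \<in> A" "T' \<in> A" "T(i := 0) = T'(i := 0)"
        have ne: "T j = T' j" if "j \<noteq> i" for j using fun_cong[OF T(3), of j] that by simp
        have "xorsum T V = xorsum T' V"
          using T V(3) unfolding A_def by (metis (mono_tags, lifting) insertI1 mem_Collect_eq xor_eq_0_iff)
        then have "T i XOR xorsum T (V - {i}) = T' i XOR xorsum T' (V - {i})"
          using xorsum.remove[OF V(1) i] by metis
        moreover have "xorsum T (V - {i}) = xorsum T' (V - {i})" using ne by (intro xorsum.cong) auto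
        ultimately have "T i = T' i" by (metis xor.assoc xor.right_neutral xor_self_eq)
        with ne show "T = T'" by (metis ext)
      qed
    qed
    moreover have "card B * (2 ^ m) ^ card L \<le> (2 ^ m) ^ card (I - {i})"
      unfolding B_def using insert.prems(1) aff nz by (intro insert.IH) auto
    ultimately have "card A * (2 ^ m) ^ card L \<le> (2 ^ m) ^ card (I - {i})"
      by (meson le_trans mult_le_mono1)
    then have "card A * (2 ^ m) ^ card L * 2 ^ m \<le> (2 ^ m) ^ card (I - {i}) * 2 ^ m" by simp
    moreover have "card I = Suc (card (I - {i}))" using iI insert.prems(1) by (metis card_Suc_Diff1)
    ultimately show ?thesis unfolding A_def using insert.hyps by (simp add: mult_ac)
  qed
qed

section \<open>Tornado tabulation\<close>

lemma simtab_eq_xorsum: "simtab T b x = xorsum (\<lambda>j. T j (x ! j)) {..<b}"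
proof -
  have "fold (\<lambda>j acc. acc XOR T j (x ! j)) [0..<b] 0 = xorsum (\<lambda>j. T j (x ! j)) {..<b}"
    by (induction b) (simp_all add: lessThan_Suc xor.commute)
  then show ?thesis unfolding simtab_def .
qed

lemma simtab_xor: "simtab (\<lambda>j a. S j a XOR T j a) b x = simtab S b x XOR simtab T b x"
  unfolding simtab_eq_xorsum by (rule xorsum.distrib)

lemma simtab_cong: "(\<And>j. j < b \<Longrightarrow> S j (x ! j) = T j (y ! j)) \<Longrightarrow> simtab S b x = simtab T b y"
  unfolding simtab_eq_xorsum by (rule xorsum.cong) auto

lemma simtab_0: "simtab (\<lambda>j a. 0) b x = 0"
  unfolding simtab_eq_xorsum by simp

lemma simtab_Suc_append:
  "length z = b \<Longrightarrow> simtab S (Suc b) (z @ [a]) = simtab S b z XOR S b a"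
  using simtab_cong[of b S "z @ [a]" S z]
  unfolding simtab_eq_xorsum by (simp add: lessThan_Suc nth_append xor.commute)

text \<open>Indicator tables serve as test functionals that read off single characters of a
  key.\<close>

lemma simtab_single:
  "simtab (\<lambda>j a. if j = j0 \<and> a = a0 then 1 else 0) b x = (if j0 < b \<and> x ! j0 = a0 then 1 else 0)"
proof -
  have "xorsum (\<lambda>j. if j = j0 \<and> x ! j = a0 then 1 else 0) {..<b}
      = (if odd (card {j\<in>{..<b}. j = j0 \<and> x ! j = a0}) then 1 else 0)"
    by (rule xorsum_if_const) simp
  moreover have "{j\<in>{..<b}. j = j0 \<and> x ! j = a0} = (if j0 < b \<and> x ! j0 = a0 then {j0} else {})" by auto
  ultimately show ?thesis unfolding simtab_eq_xorsum by simp
qed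

lemma affine_xor_simtab:
  assumes "\<And>j. j < b \<Longrightarrow> x ! j < 2 ^ k"
  shows "affine_xor ({..<b} \<times> {..<2 ^ k}) (\<lambda>S. simtab (curry S) b x)"
proof -
  have "simtab (curry S) b x = xorsum S ((\<lambda>j. (j, x ! j)) ` {..<b})" for S
    unfolding simtab_eq_xorsum by (subst xorsum.reindex) (auto intro: inj_onI)
  then show ?thesis
    unfolding affine_xor_def using assms
    by (intro exI[of _ "(\<lambda>j. (j, x ! j)) ` {..<b}"] exI[of _ 0]) auto
qed

section \<open>Table spaces of single simple tabulation functions\<close>

definition char_tables :: "nat \<Rightarrow> nat \<Rightarrow> nat \<Rightarrow> (nat \<Rightarrow> nat \<Rightarrow> nat) set" where
  "char_tables k b m = {T. \<forall>j a. (j < b \<and> a < 2 ^ k \<longrightarrow> T j a < 2 ^ m) \<and> (\<not> (j < b \<and> a < 2 ^ k) \<longrightarrow> T j a = 0)}"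

lemma char_tables_eq_image: "char_tables k b m = curry ` tables ({..<b} \<times> {..<2 ^ k}) m"
proof
  show "char_tables k b m \<subseteq> curry ` tables ({..<b} \<times> {..<2 ^ k}) m"
  proof
    fix T assume "T \<in> char_tables k b m"
    then have "case_prod T \<in> tables ({..<b} \<times> {..<2 ^ k}) m" unfolding char_tables_def tables_def by auto
    then show "T \<in> curry ` tables ({..<b} \<times> {..<2 ^ k}) m" by (intro image_eqI[of _ _ "case_prod T"]) auto
  qed
qed (auto simp: char_tables_def tables_def)

lemma card_char_tables_Collect:
  "card {T \<in> char_tables k b m. P T} = card {T \<in> tables ({..<b} \<times> {..<2 ^ k}) m. P (curry T)}"
proof -
  have "{T \<in> char_tables k b m. P T} = curry ` {T \<in> tables ({..<b} \<times> {..<2 ^ k}) m. P (curry T)}"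
    unfolding char_tables_eq_image by auto
  moreover have "inj_on curry A" for A :: "(nat \<times> nat \<Rightarrow> nat) set"
    by (rule inj_onI) (metis case_prod_curry)
  ultimately show ?thesis by (simp add: card_image)
qed

lemma finite_char_tables: "finite (char_tables k b m)"
  unfolding char_tables_eq_image by (intro finite_imageI finite_tables) auto

lemma card_char_tables: "card (char_tables k b m) = (2 ^ m) ^ card ({..<b} \<times> {..<2 ^ k :: nat})"
  using card_char_tables_Collect[of k b m "\<lambda>_. True"] by (simp add: card_tables)

lemma card_char_tables_pos: "0 < card (char_tables k b m)"
  unfolding card_char_tables by simp

lemma simtab_less:
  assumes "T \<in> char_tables k b m" shows "simtab T b x < 2 ^ m"
  unfolding simtab_eq_xorsum
proof (rule xorsum_less)
  fix j show "T j (x ! j) < 2 ^ m"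
    using assms unfolding char_tables_def by (cases "j < b \<and> x ! j < 2 ^ k") auto
qed

text \<open>Gaussian elimination for equations that sum hash values over sets of keys. The test
  tables \<open>S\<close> are unbounded, while solutions are counted among tables with
  \<open>m\<close>-bit entries.\<close>

lemma card_tabulation_system_le:
  assumes "finite L" "\<And>l x. l \<in> L \<Longrightarrow> x \<in> A l \<Longrightarrow> \<forall>j<b. key x ! j < 2 ^ k"
    and "\<And>P. P \<subseteq> L \<Longrightarrow> P \<noteq> {} \<Longrightarrow> \<exists>S. xorsum (\<lambda>l. xorsum (\<lambda>x. simtab S b (key x) XOR off x) (A l)) P \<noteq> 0"
  shows "card {T \<in> char_tables k b m. \<forall>l\<in>L. xorsum (\<lambda>x. simtab T b (key x) XOR off x) (A l) = 0} * (2 ^ m) ^ card L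
    \<le> card (char_tables k b m)"
  unfolding card_char_tables card_char_tables_Collect
proof (rule card_affine_system_le)
  fix l assume "l \<in> L"
  then show "affine_xor ({..<b} \<times> {..<2 ^ k}) (\<lambda>T. xorsum (\<lambda>x. simtab (curry T) b (key x) XOR off x) (A l))"
    using assms(2) by (intro affine_xor_xorsum affine_xor_xor affine_xor_const affine_xor_simtab) auto
next
  fix P assume "P \<subseteq> L" "P \<noteq> {}"
  from assms(3)[OF this] obtain S
    where S: "xorsum (\<lambda>l. xorsum (\<lambda>x. simtab S b (key x) XOR off x) (A l)) P \<noteq> 0" by blast
  then show "\<exists>T. xorsum (\<lambda>l. xorsum (\<lambda>x. simtab (curry T) b (key x) XOR off x) (A l)) P \<noteq> 0"
    by (intro exI[of _ "case_prod S"]) simp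
qed (use assms(1) in auto)

text \<open>The summand of the derived character of level \<^term>\<open>i\<close> that is not a table entry: only the
  twisted character, level 0, has one.\<close>
definition offset :: "nat \<Rightarrow> nat \<Rightarrow> nat list \<Rightarrow> nat" where
  "offset c i x = (if i = 0 then x ! (c - 1) else 0)"

text \<open>The first \<open>c + i - 1\<close> characters of the derived key. Starting from
  \<open>c - 1\<close> characters turns the twisted character into an ordinary level, namely level
  0.\<close>

fun prefix_key :: "(nat \<Rightarrow> nat \<Rightarrow> nat \<Rightarrow> nat) \<Rightarrow> nat \<Rightarrow> nat \<Rightarrow> nat list \<Rightarrow> nat list" where
  "prefix_key Tt c 0 x = take (c - 1) x"
| "prefix_key Tt c (Suc i) x = prefix_key Tt c i x
     @ [simtab (Tt i) (c + i - 1) (prefix_key Tt c i x) XOR offset c i x]"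

definition derived_char :: "(nat \<Rightarrow> nat \<Rightarrow> nat \<Rightarrow> nat) \<Rightarrow> nat \<Rightarrow> nat \<Rightarrow> nat list \<Rightarrow> nat" where
  "derived_char Tt c i x = simtab (Tt i) (c + i - 1) (prefix_key Tt c i x) XOR offset c i x"

text \<open>The sets of keys whose prefixes of \<^term>\<open>c + i - 1\<close> characters contain every position character
  an even number of times, phrased by duality with simple tabulation. At level 0 the last
  characters must moreover have xor 0.\<close>
definition key_kernel :: "(nat \<Rightarrow> nat \<Rightarrow> nat \<Rightarrow> nat) \<Rightarrow> nat \<Rightarrow> nat \<Rightarrow> nat list set set" where
  "key_kernel Tt c i = {Z. finite Z \<and>
     (\<forall>S. xorsum (\<lambda>x. simtab S (c + i - 1) (prefix_key Tt c i x) XOR offset c i x) Z = 0)}"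

section \<open>Derived keys and the descent of dependent sets\<close>

lemma derived_key_eq: "derived_key Tt c d x = prefix_key Tt c (Suc d) x"
proof -
  have "tornado_ext Tt c i (prefix_key Tt c 1 x) = prefix_key Tt c (Suc i) x" for i
    by (induction i) (simp_all add: Let_def offset_def)
  moreover have "prefix_key Tt c 1 x
      = take (c - 1) x @ [x ! (c - 1) XOR simtab (Tt 0) (c - 1) (take (c - 1) x)]"
    by (simp add: offset_def xor.commute)
  ultimately show ?thesis unfolding derived_key_def by metis
qed

lemma length_prefix_key: "length x = c \<Longrightarrow> 1 \<le> c \<Longrightarrow> length (prefix_key Tt c i x) = c + i - 1"
  by (induction i) auto

lemma prefix_key_cong: "(\<And>j. j < i \<Longrightarrow> Tt j = Tt' j) \<Longrightarrow> prefix_key Tt c i x = prefix_key Tt' c i x"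
  by (induction i) auto

lemma derived_tables_eq: "derived_tables k c d
  = {Tt. \<forall>i. (i \<le> d \<longrightarrow> Tt i \<in> char_tables k (c + i - 1) k) \<and> (\<not> i \<le> d \<longrightarrow> Tt i = (\<lambda>j a. 0))}"
  unfolding derived_tables_def char_tables_def by (auto simp: fun_eq_iff)

lemma final_tables_eq: "final_tables k r c d = char_tables k (c + d) r"
  unfolding final_tables_def char_tables_def ..

lemma finite_derived_tables: "finite (derived_tables k c d)"
proof (rule finite_subset)
  show "derived_tables k c d \<subseteq> {Tt. \<forall>i. (i \<in> {..d} \<longrightarrow> Tt i \<in> (\<Union>i\<le>d. char_tables k (c + i - 1) k))
    \<and> (i \<notin> {..d} \<longrightarrow> Tt i = (\<lambda>j a. 0))}"
    unfolding derived_tables_eq by auto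
  show "finite {Tt. \<forall>i. (i \<in> {..d} \<longrightarrow> Tt i \<in> (\<Union>i\<le>d. char_tables k (c + i - 1) k))
    \<and> (i \<notin> {..d} \<longrightarrow> Tt i = (\<lambda>j a. 0))}"
    by (rule finite_set_of_finite_funs) (auto intro: finite_char_tables)
qed

lemma zero_in_derived_tables: "(\<lambda>i j a. 0) \<in> derived_tables k c d"
  unfolding derived_tables_def by auto

text \<open>A test table \<open>S\<close> for level \<open>i\<close> is lifted to \<open>S'\<close>,
  which adds the tables \<open>Tt i\<close> on the old positions and is the identity on the new one.
  The new character is the hash value xored with the offset, so the hash value cancels and the test
  by \<open>S\<close> remains.\<close>

lemma key_kernel_Suc:
  assumes "1 \<le> c" "\<And>x. x \<in> Z \<Longrightarrow> length x = c" "Z \<in> key_kernel Tt c (Suc i)"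
  shows "Z \<in> key_kernel Tt c i"
proof -
  define b where "b = c + i - 1"
  have b: "c + Suc i - 1 = Suc b" using assms(1) unfolding b_def by simp
  have "xorsum (\<lambda>x. simtab S b (prefix_key Tt c i x) XOR offset c i x) Z = 0" for S
  proof -
    define S' where "S' j a = (if j < b then S j a XOR Tt i j a else a)" for j a
    have "simtab S' (Suc b) (prefix_key Tt c (Suc i) x) XOR offset c (Suc i) x
        = simtab S b (prefix_key Tt c i x) XOR offset c i x" if "x \<in> Z" for x
    proof -
      have l: "length (prefix_key Tt c i x) = b"
        unfolding b_def using assms that by (intro length_prefix_key) auto
      have "simtab S' b (prefix_key Tt c i x) = simtab S b (prefix_key Tt c i x) XOR simtab (Tt i) b (prefix_key Tt c i x)"
        unfolding simtab_xor[symmetric] by (rule simtab_cong) (simp add: S'_def)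
      moreover have "prefix_key Tt c (Suc i) x
          = prefix_key Tt c i x @ [simtab (Tt i) b (prefix_key Tt c i x) XOR offset c i x]"
        by (simp add: b_def)
      ultimately show ?thesis
        by (simp only: simtab_Suc_append[OF l])
          (simp add: S'_def[of b] offset_def[of _ "Suc i"] xor.assoc xor_cancel)
    qed
    then have "xorsum (\<lambda>x. simtab S b (prefix_key Tt c i x) XOR offset c i x) Z
      = xorsum (\<lambda>x. simtab S' (Suc b) (prefix_key Tt c (Suc i) x) XOR offset c (Suc i) x) Z"
      by (intro xorsum.cong) auto
    then show ?thesis using assms(3) unfolding key_kernel_def b by simp
  qed
  then show ?thesis using assms(3) unfolding key_kernel_def b_def by simp
qed

text \<open>Tested with the indicator of character \<open>a\<close> at the new position, the kernel
  condition is the parity of the fibre.\<close>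

lemma key_kernel_even_fibres:
  assumes "1 \<le> c" "\<And>x. x \<in> Z \<Longrightarrow> length x = c" "Z \<in> key_kernel Tt c (Suc i)"
  shows "even (card {x\<in>Z. derived_char Tt c i x = a})"
proof -
  define b where "b = c + i - 1"
  have b: "c + Suc i - 1 = Suc b" using assms(1) unfolding b_def by simp
  define S where "S = (\<lambda>j a'. if j = b \<and> a' = a then 1 else 0 :: nat)"
  have finZ: "finite Z" using assms(3) unfolding key_kernel_def by simp
  have "simtab S (Suc b) (prefix_key Tt c (Suc i) x) XOR offset c (Suc i) x
     = (if derived_char Tt c i x = a then 1 else 0)" if "x \<in> Z" for x
  proof -
    have l: "length (prefix_key Tt c i x) = b"
      unfolding b_def using assms that by (intro length_prefix_key) auto
    show ?thesis
      unfolding S_def simtab_single using l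
      by (simp add: nth_append offset_def[of _ "Suc i"] derived_char_def b_def)
  qed
  then have "xorsum (\<lambda>x. if derived_char Tt c i x = a then 1 else 0) Z
    = xorsum (\<lambda>x. simtab S (Suc b) (prefix_key Tt c (Suc i) x) XOR offset c (Suc i) x) Z"
    by (intro xorsum.cong) auto
  also have "\<dots> = 0" using assms(3) unfolding key_kernel_def b by simp
  finally show ?thesis using xorsum_if_const[OF finZ, of "\<lambda>x. derived_char Tt c i x = a" 1]
    by (simp split: if_splits)
qed

text \<open>The zero table reads off the last character through the offset; indicator tables then
  read off the others.\<close>

lemma key_determined:
  assumes "length x = c" "length y = c" "1 \<le> c"
    and eq: "\<And>S. simtab S (c + 0 - 1) (prefix_key Tt c 0 x) XOR offset c 0 x
      = simtab S (c + 0 - 1) (prefix_key Tt c 0 y) XOR offset c 0 y"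
  shows "x = y"
proof -
  have last: "x ! (c - 1) = y ! (c - 1)"
    using eq[of "\<lambda>j a. 0"] by (simp add: simtab_0 offset_def)
  have "x ! j = y ! j" if j: "j < c - 1" for j
  proof (rule ccontr)
    assume "x ! j \<noteq> y ! j"
    then show False
      using eq[of "\<lambda>j' a. if j' = j \<and> a = x ! j then 1 else 0"] j last
      unfolding simtab_single by (auto simp: offset_def xor_eq_0_iff dest: arg_cong[of _ _ "\<lambda>z. z XOR y ! (c - 1)"] simp: xor.assoc)
  qed
  then have "x ! j = y ! j" if "j < c" for j using that last by (cases "j = c - 1") auto
  then show ?thesis using assms by (intro nth_equalityI) auto
qed

lemma key_kernel_0_unique:
  assumes "1 \<le> c" "length x = c" "length y = c" "x \<notin> Z" "y \<notin> Z"
    "insert x Z \<in> key_kernel Tt c 0" "insert y Z \<in> key_kernel Tt c 0"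
  shows "x = y"
proof (rule key_determined[OF assms(2,3,1)])
  fix S
  have "finite Z" using assms(6) unfolding key_kernel_def by simp
  then show "simtab S (c + 0 - 1) (prefix_key Tt c 0 x) XOR offset c 0 x
      = simtab S (c + 0 - 1) (prefix_key Tt c 0 y) XOR offset c 0 y"
    using assms(4-7) unfolding key_kernel_def by (auto simp: xor_eq_0_iff)
qed

lemma key_kernel_0_pair:
  assumes "1 \<le> c" "length x = c" "length y = c" "x \<noteq> y"
  shows "{x, y} \<notin> key_kernel Tt c 0"
proof
  assume k: "{x, y} \<in> key_kernel Tt c 0"
  have "x = y"
    using k assms(4) by (intro key_determined[OF assms(2,3,1), of Tt]) (auto simp: key_kernel_def xor_eq_0_iff)
  with assms(4) show False by simp
qed

section \<open>Resampling the tables of one level\<close>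

lemma prefix_key_nth_less:
  assumes "Tt \<in> derived_tables k c d" "1 \<le> c" "length x = c" "\<forall>a\<in>set x. a < 2 ^ k" "i \<le> Suc d"
  shows "\<forall>j<c + i - 1. prefix_key Tt c i x ! j < 2 ^ k"
  using assms(5)
proof (induction i)
  case 0
  then show ?case using assms by (auto simp: nth_mem)
next
  case (Suc i)
  have l: "length (prefix_key Tt c i x) = c + i - 1" using assms by (intro length_prefix_key) auto
  have "Tt i \<in> char_tables k (c + i - 1) k" using assms(1) Suc.prems unfolding derived_tables_eq by auto
  then have "simtab (Tt i) (c + i - 1) (prefix_key Tt c i x) < 2 ^ k" by (rule simtab_less)
  moreover have "offset c i x < 2 ^ k" unfolding offset_def using assms by (auto simp: nth_mem)
  ultimately have "simtab (Tt i) (c + i - 1) (prefix_key Tt c i x) XOR offset c i x < 2 ^ k"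
    by (rule xor_nat_less)
  then show ?case using Suc l by (auto simp: nth_append)
qed

text \<open>Condition on all tables except those of level \<open>i\<close>. \<open>P\<close> does
  not see the latter, so the bound for a random choice of them can be summed.\<close>

lemma resample_le:
  assumes "i \<le> d" and P: "\<And>Tt T. P (Tt(i := T)) = P Tt"
    and Q: "\<And>Tt. Tt \<in> derived_tables k c d \<Longrightarrow> P Tt \<Longrightarrow>
      card {T \<in> char_tables k (c + i - 1) k. Q (Tt(i := T))} * q \<le> card (char_tables k (c + i - 1) k)"
  shows "card {Tt \<in> derived_tables k c d. P Tt \<and> Q Tt} * q \<le> card {Tt \<in> derived_tables k c d. P Tt}"
proof -
  define C where "C = char_tables k (c + i - 1) k"
  \<comment> \<open>The zero table at level \<open>i\<close> marks one representative for each
    choice of the other tables.\<close>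
  define B where "B = {Tt \<in> derived_tables k c d. P Tt \<and> Tt i = (\<lambda>j a. 0)}"
  have finB: "finite B" unfolding B_def using finite_derived_tables[of k c d] by auto
  have upd: "Tt(i := T) \<in> derived_tables k c d" if "Tt \<in> derived_tables k c d" "T \<in> C" for Tt T
    using that assms(1) unfolding derived_tables_eq C_def by auto
  have zC: "(\<lambda>j a. 0) \<in> C" unfolding C_def char_tables_def by simp
  have card_fibres: "card {Tt \<in> derived_tables k c d. P Tt \<and> R Tt} = (\<Sum>Tt\<in>B. card {T\<in>C. R (Tt(i := T))})" for R
  proof -
    have "bij_betw (\<lambda>(Tt, T). Tt(i := T)) (SIGMA Tt:B. {T\<in>C. R (Tt(i := T))})
      {Tt \<in> derived_tables k c d. P Tt \<and> R Tt}"
    proof (rule bij_betw_byWitness[where f' = "\<lambda>Tt. (Tt(i := (\<lambda>j a. 0)), Tt i)"])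
      show "\<forall>p\<in>SIGMA Tt:B. {T\<in>C. R (Tt(i := T))}.
          (\<lambda>Tt. (Tt(i := (\<lambda>j a. 0)), Tt i)) ((\<lambda>(Tt, T). Tt(i := T)) p) = p"
        unfolding B_def by (auto simp: fun_upd_idem)
      show "\<forall>Tt\<in>{Tt \<in> derived_tables k c d. P Tt \<and> R Tt}.
          (case (Tt(i := (\<lambda>j a. 0)), Tt i) of (Tt, T) \<Rightarrow> Tt(i := T)) = Tt" by simp
      show "(\<lambda>(Tt, T). Tt(i := T)) ` (SIGMA Tt:B. {T\<in>C. R (Tt(i := T))})
          \<subseteq> {Tt \<in> derived_tables k c d. P Tt \<and> R Tt}"
        using upd P unfolding B_def by auto
      show "(\<lambda>Tt. (Tt(i := (\<lambda>j a. 0)), Tt i)) ` {Tt \<in> derived_tables k c d. P Tt \<and> R Tt}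
          \<subseteq> (SIGMA Tt:B. {T\<in>C. R (Tt(i := T))})"
        using upd[OF _ zC] P assms(1) unfolding B_def by (auto simp: C_def derived_tables_eq)
    qed
    from bij_betw_same_card[OF this]
    have "card {Tt \<in> derived_tables k c d. P Tt \<and> R Tt} = card (SIGMA Tt:B. {T\<in>C. R (Tt(i := T))})"
      by (rule sym)
    also have "\<dots> = (\<Sum>Tt\<in>B. card {T\<in>C. R (Tt(i := T))})"
      using finB finite_char_tables unfolding C_def by (intro card_SigmaI) auto
    finally show ?thesis .
  qed
  have "card {Tt \<in> derived_tables k c d. P Tt \<and> Q Tt} * q = (\<Sum>Tt\<in>B. card {T\<in>C. Q (Tt(i := T))} * q)"
    unfolding card_fibres sum_distrib_right ..
  also have "\<dots> \<le> (\<Sum>Tt\<in>B. card C)"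
    using Q unfolding B_def C_def by (intro sum_mono) auto
  also have "\<dots> = card {Tt \<in> derived_tables k c d. P Tt}"
    using card_fibres[of "\<lambda>_. True"] by simp
  finally show ?thesis .
qed

text \<open>Equality of characters on a pair is the vanishing of their xor. Summing these equations
  over a subfamily tests its union, which is outside the kernel by \<open>ind\<close>.\<close>

lemma card_matched_tables_le:
  assumes "Tt \<in> derived_tables k c d" "1 \<le> c" "i \<le> d" "matching E"
    and keys: "\<And>x. x \<in> \<Union>E \<Longrightarrow> length x = c \<and> (\<forall>a\<in>set x. a < 2 ^ k)"
    and ind: "indep (key_kernel Tt c i) E"
  shows "card {T \<in> char_tables k (c + i - 1) k. matched (derived_char (Tt(i := T)) c i) E} * (2 ^ k) ^ card E
    \<le> card (char_tables k (c + i - 1) k)"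
proof -
  define b where "b = c + i - 1"
  define \<phi> where "\<phi> T x = simtab T b (prefix_key Tt c i x) XOR offset c i x" for T x
  have finE: "finite E" using assms(4) by (simp add: matching_def)
  have dc: "derived_char (Tt(i := T)) c i x = \<phi> T x" for T x
    unfolding derived_char_def \<phi>_def b_def using prefix_key_cong[of i "Tt(i := T)" Tt c x] by simp
  have "{T \<in> char_tables k b k. matched (derived_char (Tt(i := T)) c i) E}
    \<subseteq> {T \<in> char_tables k b k. \<forall>e\<in>E. xorsum (\<phi> T) e = 0}"
  proof safe
    fix T e assume m: "matched (derived_char (Tt(i := T)) c i) E" and e: "e \<in> E"
    from e have "card e = 2" using assms(4) unfolding matching_def by simp
    then obtain x y where xy: "e = {x, y}" "x \<noteq> y" unfolding card_2_iff by blast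
    have "\<phi> T x = \<phi> T y"
      by (rule m[unfolded matched_def dc, rule_format, OF e]) (simp_all add: xy(1))
    then show "xorsum (\<phi> T) e = 0" using xy by (simp add: xor_eq_0_iff)
  qed
  then have "card {T \<in> char_tables k b k. matched (derived_char (Tt(i := T)) c i) E}
    \<le> card {T \<in> char_tables k b k. \<forall>e\<in>E. xorsum (\<phi> T) e = 0}"
    using finite_char_tables[of k b k] by (intro card_mono) auto
  moreover have "card {T \<in> char_tables k b k. \<forall>e\<in>E. xorsum (\<phi> T) e = 0} * (2 ^ k) ^ card E \<le> card (char_tables k b k)"
    unfolding \<phi>_def
  proof (rule card_tabulation_system_le[OF finE])
    fix e x assume "e \<in> E" "x \<in> e"
    then show "\<forall>j<b. prefix_key Tt c i x ! j < 2 ^ k"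
      unfolding b_def using keys[of x] assms by (intro prefix_key_nth_less) auto
  next
    fix P assume P: "P \<subseteq> E" "P \<noteq> {}"
    have mP: "matching P" by (rule matching_subset[OF assms(4) P(1)])
    have "\<Union>P \<notin> key_kernel Tt c i" using ind P unfolding indep_def by auto
    then obtain S where S: "xorsum (\<phi> S) (\<Union>P) \<noteq> 0"
      using finite_Union_matching[OF mP] unfolding key_kernel_def \<phi>_def b_def by auto
    moreover have "xorsum (\<phi> S) (\<Union>P) = xorsum (\<lambda>e. xorsum (\<phi> S) e) P"
    proof -
      have "xorsum (\<phi> S) (\<Union>P) = (xorsum \<circ> xorsum) (\<phi> S) P"
        using mP by (intro xorsum.Union_disjoint)
          (auto simp: matching_def pairwise_def disjnt_def card_2_iff)
      then show ?thesis by simp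
    qed
    ultimately show "\<exists>S. xorsum (\<lambda>e. xorsum (\<lambda>x. simtab S b (prefix_key Tt c i x) XOR offset c i x) e) P \<noteq> 0"
      unfolding \<phi>_def by metis
  qed
  ultimately show ?thesis unfolding b_def by (meson le_trans mult_le_mono1)
qed

lemma kernel_levels_tornado:
  assumes "k \<ge> 8" and "c \<ge> 1" and "d \<ge> 1"
    and X: "X \<subseteq> {x. length x = c \<and> (\<forall>a \<in> set x. a < 2 ^ k)}" and "finite X" and "2 * card X \<le> 2 ^ k"
  shows "kernel_levels (derived_tables k c d) (\<lambda>i Tt Tt'. \<forall>j<i. Tt j = Tt' j) X (\<lambda>i Tt. key_kernel Tt c i)
    (key_kernel (\<lambda>i j a. 0) c 0) (\<lambda>i Tt. derived_char Tt c i) (2 ^ k) d"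
proof
  show "finite (derived_tables k c d)" by (rule finite_derived_tables)
  show "(256::real) \<le> 2 ^ k" using power_increasing[OF assms(1), of "2::real"] by simp
  show "2 * real (card X) \<le> 2 ^ k" using of_nat_mono[OF assms(6), where 'a = real] by simp
  fix i w w'
  show "\<forall>j<i. w j = w' j" if "\<forall>j<Suc i. w j = w' j" for w w' :: "nat \<Rightarrow> nat \<Rightarrow> nat \<Rightarrow> nat"
    using that by simp
  show "key_kernel w c i = key_kernel w' c i" if "\<forall>j<i. w j = w' j"
    using prefix_key_cong[of i w w' c] that unfolding key_kernel_def by simp
  show "derived_char w c i = derived_char w' c i" if "\<forall>j<Suc i. w j = w' j"
  proof -
    have "w i = w' i" "\<And>x. prefix_key w c i x = prefix_key w' c i x"
      using that prefix_key_cong[of i w w' c] by auto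
    then show ?thesis unfolding derived_char_def by simp
  qed
  show "key_kernel w c 0 = key_kernel (\<lambda>i j a. 0) c 0" unfolding key_kernel_def by simp
next
  fix w Z i assume "Z \<subseteq> X" "Z \<in> key_kernel w c (Suc i)"
  then show "Z \<in> key_kernel w c i" using X assms(2) by (auto intro!: key_kernel_Suc[of c Z w i])
next
  fix w Z i a assume "Z \<subseteq> X" "Z \<in> key_kernel w c (Suc i)"
  then show "even (card {x\<in>Z. derived_char w c i x = a})" using X assms(2) by (intro key_kernel_even_fibres) auto
next
  fix x y assume "x \<in> X" "y \<in> X" "x \<noteq> y"
  then show "{x, y} \<notin> key_kernel (\<lambda>i j a. 0) c 0" using X assms(2) by (intro key_kernel_0_pair) auto
next
  fix Z x y assume "x \<in> X - Z" "y \<in> X - Z" "insert x Z \<in> key_kernel (\<lambda>i j a. 0) c 0"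
    "insert y Z \<in> key_kernel (\<lambda>i j a. 0) c 0"
  then show "x = y" using X assms(2) by (intro key_kernel_0_unique[of c x y Z]) auto
next
  fix i E P
  assume i: "i \<le> d" and E: "matching E" "\<Union>E \<subseteq> X"
    and P: "\<And>w w'. \<forall>j<i. w j = w' j \<Longrightarrow> P w = P w'"
    and ind: "\<And>w. w \<in> derived_tables k c d \<Longrightarrow> P w \<Longrightarrow> indep (key_kernel w c i) E"
  have "card {w \<in> derived_tables k c d. P w \<and> matched (derived_char w c i) E} * (2 ^ k) ^ card E
    \<le> card {w \<in> derived_tables k c d. P w}"
  proof (rule resample_le[OF i])
    fix Tt T show "P (Tt(i := T)) = P Tt" by (rule P) simp
  next
    fix Tt assume "Tt \<in> derived_tables k c d" "P Tt"
    then show "card {T \<in> char_tables k (c + i - 1) k. matched (derived_char (Tt(i := T)) c i) E} * (2 ^ k) ^ card E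
      \<le> card (char_tables k (c + i - 1) k)"
      using assms(2) i E(1) subset_trans[OF E(2) X] ind by (intro card_matched_tables_le) auto
  qed
  from of_nat_mono[OF this, where 'a = real]
  have "real (card {w \<in> derived_tables k c d. P w \<and> matched (derived_char w c i) E}) * (2 ^ k) ^ card E
    \<le> real (card {w \<in> derived_tables k c d. P w})" by simp
  then show "dens (derived_tables k c d) (\<lambda>w. P w \<and> matched (derived_char w c i) E) * (2 ^ k) ^ card E
    \<le> dens (derived_tables k c d) P"
    unfolding dens_def by (simp add: divide_right_mono)
qed (use assms in auto)

text \<open>Every fibre has at most the average size, hence exactly the average size.\<close>
lemma card_tabulation_fibre:
  fixes key :: "'x \<Rightarrow> nat list"
  assumes "finite X" "\<And>x. x \<in> X \<Longrightarrow> \<forall>j<b. key x ! j < 2 ^ k"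
    and ind: "\<And>P. P \<subseteq> X \<Longrightarrow> P \<noteq> {} \<Longrightarrow> \<exists>S. xorsum (\<lambda>x. simtab S b (key x)) P \<noteq> 0"
    and f: "f \<in> X \<rightarrow>\<^sub>E {0..<2 ^ r}"
  shows "real (card {T \<in> char_tables k b r. restrict (\<lambda>x. simtab T b (key x)) X = f})
    = real (card (char_tables k b r)) / (2 ^ r) ^ card X"
proof -
  define C where "C = char_tables k b r"
  define cnt where "cnt g = card {T \<in> C. restrict (\<lambda>x. simtab T b (key x)) X = g}" for g
  let ?F = "X \<rightarrow>\<^sub>E {0..<2 ^ r :: nat}"
  have finF: "finite ?F" using assms(1) by (intro finite_PiE) auto
  have finC: "finite C" unfolding C_def by (rule finite_char_tables)
  have le: "real (cnt g) \<le> real (card C) / (2 ^ r) ^ card X" if g: "g \<in> ?F" for g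
  proof -
    \<comment> \<open>Having \<open>g\<close> as hash values amounts to one affine equation per
      key.\<close>
    have "{T \<in> C. restrict (\<lambda>x. simtab T b (key x)) X = g}
      \<subseteq> {T \<in> C. \<forall>x\<in>X. xorsum (\<lambda>y. simtab T b (key y) XOR g y) {x} = 0}"
      by (auto simp: xor_eq_0_iff)
    then have "cnt g \<le> card {T \<in> C. \<forall>x\<in>X. xorsum (\<lambda>y. simtab T b (key y) XOR g y) {x} = 0}"
      unfolding cnt_def using finC by (intro card_mono) auto
    moreover have "card {T \<in> C. \<forall>x\<in>X. xorsum (\<lambda>y. simtab T b (key y) XOR g y) {x} = 0} * (2 ^ r) ^ card X \<le> card C"
      unfolding C_def
    proof (rule card_tabulation_system_le[OF assms(1)])
      fix P assume P: "P \<subseteq> X" "P \<noteq> {}"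
      show "\<exists>S. xorsum (\<lambda>x. xorsum (\<lambda>y. simtab S b (key y) XOR g y) {x}) P \<noteq> 0"
      proof (rule ccontr)
        assume "\<not> ?thesis"
        then have z: "xorsum (\<lambda>x. simtab S b (key x)) P XOR xorsum g P = 0" for S
          by (simp add: xorsum.distrib)
        \<comment> \<open>The zero table isolates the constant part; once it vanishes, the linear
          part contradicts \<open>ind\<close>.\<close>
        have "xorsum g P = 0" using z[of "\<lambda>j a. 0"] by (simp add: simtab_0)
        then show False using z ind[OF P] by simp
      qed
    qed (use assms(2) in auto)
    ultimately have "cnt g * (2 ^ r) ^ card X \<le> card C" by (meson le_trans mult_le_mono1)
    from of_nat_mono[OF this, where 'a = real]
    have "real (cnt g) * (2 ^ r) ^ card X \<le> real (card C)" by simp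
    then show ?thesis by (simp add: pos_le_divide_eq)
  qed
  have "(\<Sum>g\<in>?F. cnt g) = card C"
  proof -
    have "C = (\<Union>g\<in>?F. {T \<in> C. restrict (\<lambda>x. simtab T b (key x)) X = g})"
    proof (intro equalityI subsetI)
      fix T assume T: "T \<in> C"
      then have "restrict (\<lambda>x. simtab T b (key x)) X \<in> ?F" using simtab_less[of T k b r] unfolding C_def by auto
      then show "T \<in> (\<Union>g\<in>?F. {T \<in> C. restrict (\<lambda>x. simtab T b (key x)) X = g})" using T by blast
    qed blast
    then have "card C = card (\<Union>g\<in>?F. {T \<in> C. restrict (\<lambda>x. simtab T b (key x)) X = g})" by simp
    also have "\<dots> = (\<Sum>g\<in>?F. cnt g)"
      unfolding cnt_def using finF finC by (intro card_UN_disjoint) auto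
    finally show ?thesis by simp
  qed
  then have "(\<Sum>g\<in>?F. real (cnt g)) = real (card C)" by (metis of_nat_sum)
  moreover have "(\<Sum>g\<in>?F. real (card C) / (2 ^ r) ^ card X) = real (card C)"
    using assms(1) by (simp add: card_PiE)
  ultimately have "(\<Sum>g\<in>?F. real (card C) / (2 ^ r) ^ card X - real (cnt g)) = 0"
    by (simp add: sum_subtractf)
  then have "\<forall>g\<in>?F. real (card C) / (2 ^ r) ^ card X - real (cnt g) = 0"
    using sum_nonneg_eq_0_iff[OF finF] le by (metis (no_types, lifting) diff_ge_0_iff_ge)
  then show ?thesis using f unfolding cnt_def C_def by simp
qed

text \<open>The event is that the derived tables leave no nonempty dependent subset of
  \<open>X\<close>. It does not involve the final tables, so for each such choice of derived tables
  the final hash values are uniform, and summing over the choices preserves this.\<close>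

theorem theorem1p1:
  fixes k r c d :: nat and X :: "nat list set"
  assumes "k \<ge> 8" and "c \<ge> 1" and "d \<ge> 1"
    and "X \<subseteq> {x. length x = c \<and> (\<forall>a \<in> set x. a < 2^k)}"
    and "2 * card X \<le> 2^k"
  shows "fully_random_whp (tornado_space k r c d) (tornado_hash c d) X {0..<2^r}
           (1 - 7 * real (card X) ^ 3 * (3 / 2^k) ^ (d + 1) - 1 / 2 ^ (2^k div 2))"
proof -
  have "finite {x. set x \<subseteq> {..<2 ^ k :: nat} \<and> length x = c}" by (rule finite_lists_length_eq) simp
  then have finX: "finite X" by (rule rev_finite_subset) (use assms(4) in auto)
  define DT where "DT = derived_tables k c d"
  define FT where "FT = char_tables k (c + d) r"
  define bad where "bad Tt \<longleftrightarrow> (\<exists>Z\<subseteq>X. Z \<noteq> {} \<and> Z \<in> key_kernel Tt c (Suc d))" for Tt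
  define E where "E = {w :: (nat \<Rightarrow> nat \<Rightarrow> nat \<Rightarrow> nat) \<times> (nat \<Rightarrow> nat \<Rightarrow> nat). \<not> bad (fst w)}"
  have fin: "finite DT" "finite FT" unfolding DT_def FT_def by (rule finite_derived_tables finite_char_tables)+
  have ne: "DT \<noteq> {}" "card FT > 0" unfolding DT_def FT_def
    using zero_in_derived_tables[of k c d] card_char_tables_pos by auto
  have prob: "measure_pmf.prob (tornado_space k r c d) A = real (card ((DT \<times> FT) \<inter> A)) / (real (card DT) * real (card FT))" for A
    unfolding tornado_space_def final_tables_eq DT_def[symmetric] FT_def[symmetric]
    using fin ne by (subst measure_pmf_of_set) (auto simp: card_cartesian_product)
  have probE: "measure_pmf.prob (tornado_space k r c d) E = real (card {Tt\<in>DT. \<not> bad Tt}) / real (card DT)"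
  proof -
    have "(DT \<times> FT) \<inter> E = {Tt\<in>DT. \<not> bad Tt} \<times> FT" unfolding E_def by auto
    then show ?thesis unfolding prob using ne by (simp add: card_cartesian_product)
  qed
  have "dens DT bad \<le> 7 * real (card X) ^ 3 * (3 / 2 ^ k) ^ (d + 1)"
    unfolding DT_def bad_def
    by (rule kernel_levels.dens_Ker_nontrivial_le[OF kernel_levels_tornado[OF assms(1-4) finX assms(5)]])
  moreover have "real (card {Tt\<in>DT. \<not> bad Tt}) / real (card DT) = 1 - dens DT bad"
  proof -
    have "{Tt\<in>DT. \<not> bad Tt} = DT - {Tt\<in>DT. bad Tt}" by auto
    then have "real (card {Tt\<in>DT. \<not> bad Tt}) = real (card DT) - real (card {Tt\<in>DT. bad Tt})"
      using fin by (simp add: card_Diff_subset card_mono of_nat_diff)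
    then show ?thesis unfolding dens_def using fin ne by (simp add: diff_divide_distrib)
  qed
  \<comment> \<open>Subtracting a further nonnegative term only weakens the bound.\<close>
  moreover have "(0::real) \<le> 1 / 2 ^ (2 ^ k div 2)" by simp
  ultimately have ge: "measure_pmf.prob (tornado_space k r c d) E
      \<ge> 1 - 7 * real (card X) ^ 3 * (3 / 2^k) ^ (d + 1) - 1 / 2 ^ (2^k div 2)"
    unfolding probE by linarith
  have "measure_pmf.prob (tornado_space k r c d) {w \<in> E. restrict (tornado_hash c d w) X = f}
      = measure_pmf.prob (tornado_space k r c d) E / real (card {0..<2 ^ r :: nat}) ^ card X"
    if f: "f \<in> X \<rightarrow>\<^sub>E {0..<2 ^ r}" for f
  proof -
    define h where "h Tt T = restrict (\<lambda>x. simtab T (c + d) (prefix_key Tt c (Suc d) x)) X" for Tt T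
    have "(DT \<times> FT) \<inter> {w \<in> E. restrict (tornado_hash c d w) X = f}
      = (SIGMA Tt:{Tt\<in>DT. \<not> bad Tt}. {T\<in>FT. h Tt T = f})"
      unfolding E_def h_def by (auto simp: tornado_hash_def derived_key_eq)
    then have "real (card ((DT \<times> FT) \<inter> {w \<in> E. restrict (tornado_hash c d w) X = f}))
      = (\<Sum>Tt\<in>{Tt\<in>DT. \<not> bad Tt}. real (card {T\<in>FT. h Tt T = f}))"
      using fin by (simp add: card_SigmaI)
    also have "\<dots> = (\<Sum>Tt\<in>{Tt\<in>DT. \<not> bad Tt}. real (card FT) / (2 ^ r) ^ card X)"
    proof (rule sum.cong)
      fix Tt assume "Tt \<in> {Tt\<in>DT. \<not> bad Tt}"
      then have Tt: "Tt \<in> DT" "\<not> bad Tt" by auto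
      show "real (card {T\<in>FT. h Tt T = f}) = real (card FT) / (2 ^ r) ^ card X"
        unfolding h_def FT_def
      proof (rule card_tabulation_fibre[OF finX _ _ f])
        fix x assume "x \<in> X"
        then have "\<forall>j<c + Suc d - 1. prefix_key Tt c (Suc d) x ! j < 2 ^ k"
          using Tt(1) assms(2,4) unfolding DT_def by (intro prefix_key_nth_less[of Tt k c d]) auto
        then show "\<forall>j<c + d. prefix_key Tt c (Suc d) x ! j < 2 ^ k" by simp
      next
        fix P assume P: "P \<subseteq> X" "P \<noteq> {}"
        then have "P \<notin> key_kernel Tt c (Suc d)" "finite P"
          using Tt(2) finX unfolding bad_def by (auto intro: finite_subset)
        \<comment> \<open>At level \<open>Suc d\<close> the offset is 0, so the kernel condition is
          a test by simple tabulation alone.\<close>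
        then show "\<exists>S. xorsum (\<lambda>x. simtab S (c + d) (prefix_key Tt c (Suc d) x)) P \<noteq> 0"
          unfolding key_kernel_def by (simp add: offset_def del: prefix_key.simps)
      qed
    qed simp
    finally show ?thesis
      unfolding probE prob[of "{w \<in> E. restrict (tornado_hash c d w) X = f}"]
      using ne by (simp add: mult.commute)
  qed
  with ge show ?thesis unfolding fully_random_whp_def by blast
qed

end
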